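(* Let $n\geq 3$ and let $\mathcal{X}=2^{n+1}_{[1,n-1]}$, the two-vertex premaniplex of rank $n+1$ with links of colors $0$ and $n$ and with semi-edges of every color in $\{1,\ldots,n-1\}$ at both vertices. Then $\mathcal{X}$ is (isomorphic to) the symmetry type graph of a polytope.
   Context: All polytopes and maniplexes are assumed finite. A flagged poset of rank $N$ is a poset with a least element $F_{-1}$ and a greatest element $F_N$ all of whose maximal chains (called flags) have exactly $N+2$ elements. An element $F$ has rank $r$ if the maximal chains having $F$ as their largest element have $r+2$ elements; elements of rank $i$ are called $i$-faces. The poset satisfies the diamond condition if whenever $F<G$ and $\mathrm{rank}(G)-\mathrm{rank}(F)=2$ there are exactly two $H$ with $F<H<G$. Two flags are $i$-adjacent if they differ exactly in their $i$-face; under the diamond condition each flag $\Phi$ has a unique $i$-adjacent flag $\Phi^i$ for each $i\in\{0,\ldots,N-1\}$. The poset is strongly flag-connected if for any flags $\Phi,\Psi$ there is a sequence $\Phi=\Phi_0,\Phi_1,\ldots,\Phi_k=\Psi$ such that $\Phi_{j-1}$ and $\Phi_j$ are $i_j$-adjacent for some $i_j$ such that $\Phi$ and $\Psi$ have different $i_j$-faces. An (abstract) polytope of rank $N$ is a flagged poset of rank $N$ satisfying the diamond condition and strong flag-connectedness. Its flag-graph has the flags as vertices, with an edge of color $i$ joining each pair of $i$-adjacent flags. An $N$-premaniplex is a connected graph, possibly with multiple edges and semi-edges (edges with a single endpoint and only one orientation), with edges colored by $\{0,\ldots,N-1\}$, such that each vertex is incident to exactly one edge of each color, and for $|i-j|>1$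 the alternating paths of length 4 with colors $i,j$ are closed. An edge with two different endpoints is called a link. Isomorphisms of premaniplexes preserve colors. The symmetry type graph of a polytope $\mathcal{P}$ is the quotient of its flag-graph by the automorphism group of $\mathcal{P}$: its vertices are the flag orbits; two distinct orbits are joined by an edge of color $i$ if there are $i$-adjacent flags one in each orbit; and there is a semi-edge of color $i$ at an orbit if $i$-adjacent flags of that orbit lie in the same orbit. For a proper subset $I\subsetneq\{0,\ldots,N-1\}$, $2^N_I$ denotes the $N$-premaniplex with exactly two vertices having, for each color $i\in I$, a semi-edge of color $i$ at each of the two vertices, and, for each color $i\notin I$, a link of color $i$ joining the two vertices. $[1,n-1]=\{1,2,\ldots,n-1\}$. *)

theory Defs
  imports Main
begin

section \<open>Finite abstract polytopes\<close>

text \<open>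
  A poset is a reflexive partial order relation \<open>r\<close>; its elements are \<open>Field r\<close>.
\<close>

definition flags :: "'a rel \<Rightarrow> 'a set set" where
  "flags r = {C. pred_on.maxchain (Field r) (\<lambda>x y. (x, y) \<in> r) C}"

definition flagged_poset :: "nat \<Rightarrow> 'a rel \<Rightarrow> bool" where
  "flagged_poset N r \<longleftrightarrow>
     Partial_order r \<and>
     (\<exists>b\<in>Field r. \<forall>x\<in>Field r. (b, x) \<in> r) \<and>
     (\<exists>t\<in>Field r. \<forall>x\<in>Field r. (x, t) \<in> r) \<and>
     (\<forall>C\<in>flags r. card C = N + 2)"

definition chain_to :: "'a rel \<Rightarrow> 'a \<Rightarrow> 'a set \<Rightarrow> bool" where
  "chain_to r F C \<longleftrightarrow>
     pred_on.chain (Field r) (\<lambda>x y. (x, y) \<in> r) C \<and> F \<in> C \<and> (\<forall>G\<in>C. (G, F) \<in> r)"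

definition maxchain_to :: "'a rel \<Rightarrow> 'a \<Rightarrow> 'a set \<Rightarrow> bool" where
  "maxchain_to r F C \<longleftrightarrow> chain_to r F C \<and> (\<nexists>D. chain_to r F D \<and> C \<subset> D)"

text \<open>
  In a finite flagged poset all the chains \<open>C\<close> below have the same cardinality, so the
  description is proper. Ranks are integers because the least element has rank \<open>-1\<close>.
\<close>

definition rank :: "'a rel \<Rightarrow> 'a \<Rightarrow> int" where
  "rank r F = (THE k. \<forall>C. maxchain_to r F C \<longrightarrow> int (card C) = k + 2)"

definition diamond_condition :: "'a rel \<Rightarrow> bool" where
  "diamond_condition r \<longleftrightarrow>
     (\<forall>F G. (F, G) \<in> r \<and> F \<noteq> G \<and> rank r G - rank r F = 2 \<longrightarrow>
        card {H. (F, H) \<in> r \<and> F \<noteq> H \<and> (H, G) \<in> r \<and> H \<noteq> G} = 2)"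

text \<open>
  The \<open>i\<close>-face of a flag is represented by the set of its faces of rank \<open>i\<close>, which is a
  singleton for \<open>-1 \<le> i \<le> N\<close> and empty otherwise.
\<close>

definition face_at :: "'a rel \<Rightarrow> int \<Rightarrow> 'a set \<Rightarrow> 'a set" where
  "face_at r i \<Phi> = {F \<in> \<Phi>. rank r F = i}"

definition adjacent :: "'a rel \<Rightarrow> nat \<Rightarrow> 'a set \<Rightarrow> 'a set \<Rightarrow> bool" where
  "adjacent r i \<Phi> \<Psi> \<longleftrightarrow>
     \<Phi> \<in> flags r \<and> \<Psi> \<in> flags r \<and>
     (\<forall>j. face_at r j \<Phi> \<noteq> face_at r j \<Psi> \<longleftrightarrow> j = int i)"

definition strongly_flag_connected :: "nat \<Rightarrow> 'a rel \<Rightarrow> bool" where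
  "strongly_flag_connected N r \<longleftrightarrow>
     (\<forall>\<Phi>\<in>flags r. \<forall>\<Psi>\<in>flags r.
        (\<lambda>X Y. \<exists>i<N. adjacent r i X Y \<and> face_at r (int i) \<Phi> \<noteq> face_at r (int i) \<Psi>)\<^sup>*\<^sup>* \<Phi> \<Psi>)"

definition abstract_polytope :: "nat \<Rightarrow> 'a rel \<Rightarrow> bool" where
  "abstract_polytope N r \<longleftrightarrow>
     finite (Field r) \<and> flagged_poset N r \<and> diamond_condition r \<and> strongly_flag_connected N r"

definition poset_automorphism :: "'a rel \<Rightarrow> ('a \<Rightarrow> 'a) \<Rightarrow> bool" where
  "poset_automorphism r f \<longleftrightarrow>
     bij_betw f (Field r) (Field r) \<and>
     (\<forall>x\<in>Field r. \<forall>y\<in>Field r. (f x, f y) \<in> r \<longleftrightarrow> (x, y) \<in> r)"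


section \<open>Edge-coloured graphs and premaniplexes\<close>

text \<open>
  An edge is a pair of a colour and its set of endpoints: two endpoints for a link, one for
  a semi-edge. Parallel edges can only occur with different colours, which loses no
  generality for premaniplexes, whose vertices are incident to one edge of each colour.
  Note that \<open>(i, {x, y})\<close> is a semi-edge if \<open>x = y\<close>.
\<close>

record 'v coloured_graph =
  vertices :: "'v set"
  edges :: "(nat \<times> 'v set) set"

definition premaniplex :: "nat \<Rightarrow> 'v coloured_graph \<Rightarrow> bool" where
  "premaniplex N X \<longleftrightarrow>
     vertices X \<noteq> {} \<and>
     (\<forall>(i, e)\<in>edges X. i < N \<and> e \<subseteq> vertices X \<and> (card e = 1 \<or> card e = 2)) \<and>
     (\<forall>x\<in>vertices X. \<forall>y\<in>vertices X. (\<lambda>u v. \<exists>i. (i, {u, v}) \<in> edges X)\<^sup>*\<^sup>* x y) \<and>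
     (\<forall>x\<in>vertices X. \<forall>i<N. \<exists>!e. (i, e) \<in> edges X \<and> x \<in> e) \<and>
     (\<forall>i j v0 v1 v2 v3 v4. \<bar>int i - int j\<bar> > 1 \<longrightarrow>
        (i, {v0, v1}) \<in> edges X \<and> (j, {v1, v2}) \<in> edges X \<and>
        (i, {v2, v3}) \<in> edges X \<and> (j, {v3, v4}) \<in> edges X \<longrightarrow> v4 = v0)"

definition isomorphic :: "'v coloured_graph \<Rightarrow> 'w coloured_graph \<Rightarrow> bool" where
  "isomorphic X Y \<longleftrightarrow>
     (\<exists>\<phi>. bij_betw \<phi> (vertices X) (vertices Y) \<and>
          edges Y = (\<lambda>(i, e). (i, \<phi> ` e)) ` edges X)"

text \<open>The premaniplex \<open>2\<^sup>N\<^sub>I\<close>, for a proper subset \<open>I\<close> of \<open>{0, \<dots>, N - 1}\<close>.\<close>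

definition two_vertex :: "nat \<Rightarrow> nat set \<Rightarrow> bool coloured_graph" where
  "two_vertex N I =
     \<lparr>vertices = UNIV,
      edges = {(i, {v}) | i v. i \<in> I} \<union> {(i, {False, True}) | i. i < N \<and> i \<notin> I}\<rparr>"

lemma premaniplex_two_vertex:
  assumes "I \<subset> {..<N}"
  shows "premaniplex N (two_vertex N I)"
proof -
  let ?E = "edges (two_vertex N I)"
  have link: "(i, {u, v}) \<in> ?E \<longleftrightarrow> i < N \<and> (u = v \<longleftrightarrow> i \<in> I)" for i u v
    using assms by (cases u; cases v) (auto simp: two_vertex_def)
  obtain k where k: "k < N" "k \<notin> I"
    using assms by auto
  have conn: "(\<lambda>u v. \<exists>i. (i, {u, v}) \<in> ?E)\<^sup>*\<^sup>* x y" for x y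
  proof (cases "x = y")
    case False
    then have "(k, {x, y}) \<in> ?E"
      using k by (simp add: link)
    then show ?thesis
      by blast
  qed simp
  have unique: "\<exists>!e. (i, e) \<in> ?E \<and> x \<in> e" if "i < N" for i x
  proof (cases "i \<in> I")
    case True
    then show ?thesis
      by (intro ex1I[of _ "{x}"]) (auto simp: two_vertex_def)
  next
    case False
    then show ?thesis
      using that by (intro ex1I[of _ "{False, True}"]) (auto simp: two_vertex_def)
  qed
  have closed: "v4 = v0"
    if "(i, {v0, v1}) \<in> ?E" "(j, {v1, v2}) \<in> ?E" "(i, {v2, v3}) \<in> ?E" "(j, {v3, v4}) \<in> ?E"
    for i j v0 v1 v2 v3 v4
    using that unfolding link by argo
  have edge: "\<forall>(i, e)\<in>?E. i < N \<and> e \<subseteq> UNIV \<and> (card e = 1 \<or> card e = 2)"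
    using assms by (auto simp: two_vertex_def)
  have verts: "vertices (two_vertex N I) = UNIV"
    by (simp add: two_vertex_def)
  show ?thesis
    unfolding premaniplex_def verts
  proof (intro conjI)
    show "\<forall>x\<in>UNIV. \<forall>i<N. \<exists>!e. (i, e) \<in> ?E \<and> x \<in> e"
      using unique by simp
    show "\<forall>i j v0 v1 v2 v3 v4. \<bar>int i - int j\<bar> > 1 \<longrightarrow>
        (i, {v0, v1}) \<in> ?E \<and> (j, {v1, v2}) \<in> ?E \<and>
        (i, {v2, v3}) \<in> ?E \<and> (j, {v3, v4}) \<in> ?E \<longrightarrow> v4 = v0"
      using closed by (intro allI impI) (elim conjE)
  qed (use edge conn in simp_all)
qed


section \<open>Symmetry type graphs\<close>

definition flag_graph :: "nat \<Rightarrow> 'a rel \<Rightarrow> 'a set coloured_graph" where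
  "flag_graph N r =
     \<lparr>vertices = flags r, edges = {(i, {\<Phi>, \<Psi>}) | i \<Phi> \<Psi>. i < N \<and> adjacent r i \<Phi> \<Psi>}\<rparr>"

definition flag_orbit :: "'a rel \<Rightarrow> 'a set \<Rightarrow> 'a set set" where
  "flag_orbit r \<Phi> = {f ` \<Phi> | f. poset_automorphism r f}"

text \<open>
  An edge \<open>(i, {\<Phi>, \<Psi>})\<close> of the flag-graph is mapped to the edge of colour \<open>i\<close> whose
  endpoints are the orbits of \<open>\<Phi>\<close> and \<open>\<Psi>\<close>; this is a semi-edge if the two orbits coincide.
\<close>

definition symmetry_type_graph :: "nat \<Rightarrow> 'a rel \<Rightarrow> 'a set set coloured_graph" where
  "symmetry_type_graph N r =
     \<lparr>vertices = flag_orbit r ` vertices (flag_graph N r),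
      edges = (\<lambda>(i, e). (i, flag_orbit r ` e)) ` edges (flag_graph N r)\<rparr>"

end

theory Submission
  imports Defs "HOL-Library.Numeral_Type"
begin

text \<open>
  The polytope is obtained by gluing \<open>n\<close>-cubes. The facets of the cube \<open>{0, 1}\<^sup>n\<close> are given by a
  coordinate \<open>j\<close> and a value \<open>e\<close>; such a pair is called a letter. Take a finite set of cubes on
  which each letter acts as an involution without fixed points, and glue the facet \<open>c\<close> of each
  cube \<open>q\<close> to the facet \<open>c\<close> of the cube \<open>q c\<close> by the identity. A face of rank \<open>r\<close> is then an
  \<open>r\<close>-face of the cube, that is, a set \<open>A\<close> of \<open>r\<close> free coordinates together with values \<open>E\<close> for
  the other coordinates, and a class of cubes under the letters \<open>(j, E j)\<close> with \<open>j \<notin> A\<close>. A flag is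
  a cube, a vertex of the cube, and an order in which the coordinates are freed. Its 0-adjacent
  flag flips one coordinate of the vertex, its \<open>n\<close>-adjacent flag applies a letter to the cube, and
  the other adjacent flags transpose two neighbours in the order. That this is a polytope is easy:
  when faces of two flags agree, the cubes and the vertices differ only by letters and coordinates
  that the faces allow, and the two kinds of change do not interfere.

  Cubes are represented by words in the letters, two words standing for the same cube if they have
  the same state; a cube is then reached from the cube of the empty word by applying letters. An
  automorphism consists of a signed permutation \<open>\<kappa>\<close> of the coordinates (a symmetry of the cube)
  and a word \<open>u\<close>, and acts by \<open>w \<mapsto> u (\<kappa> w)\<close>. Suppose that this respects equality of states
  exactly if the length of \<open>u\<close> plus the number of sign changes of \<open>\<kappa>\<close> is even. Then the parity of the length
  of \<open>w\<close> plus the number of ones of the vertex classifies the flag orbits, and this parity changes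
  under 0-adjacency and \<open>n\<close>-adjacency and under no other (\<open>symmetry_type_graph_gluing\<close>).

  It remains to find such a state. For \<open>H \<subseteq> {0, \<dots>, n - 1}\<close> keep in a word only the letters \<open>(j, e)\<close>
  with \<open>e \<longleftrightarrow> j \<in> H\<close>, and count the occurrences of the coordinate \<open>j\<close> in what remains with
  alternating signs. These counts \<open>f H j\<close> live in a finite ring and transform under \<open>(u, \<kappa>)\<close> by a
  signed permutation of the pairs \<open>(H, j)\<close>, followed by a translation. Let
  \<open>(J f) H j = (-1)\<^bsup>card H\<^esup> f (complement of H) j\<close>. Every letter is kept for exactly one of \<open>H\<close> and its
  complement, so a letter commutes with \<open>J\<close> up to the sign \<open>-1\<close>; a change of one sign in \<open>\<kappa>\<close>
  does so too, because of the factor \<open>(-1)\<^bsup>card H\<^esup>\<close>. Hence exactly the even pairs \<open>(u, \<kappa>)\<close> commute with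
  \<open>J\<close>, and the odd ones exchange its two eigenspaces. Since \<open>J\<^sup>2 = (-1)\<^sup>n\<close>, a square root \<open>\<mu>\<close> of
  \<open>(-1)\<^sup>n\<close> in the ring makes \<open>f - \<mu> J f\<close> the projection (up to a factor) onto one of these
  eigenspaces, and this projection is taken as the state, together with the parity of the number of
  kept letters for each \<open>H\<close>. The even pairs respect it, the odd ones do not: there is a word whose counts lie in the eigenspace that the state ignores and do not
  vanish (\<open>chiral_word\<close>). The ring \<open>\<int>/5\<close> has the square roots 1 of 1 and 2 of \<open>-1\<close>, and 2 is
  invertible in it.
\<close>

section \<open>Posets described by their flags\<close>

lemma set_chain_iff:
  "pred_on.chain (Field r) (\<lambda>x y. (x, y) \<in> r) C \<longleftrightarrow>
     C \<subseteq> Field r \<and> (\<forall>x\<in>C. \<forall>y\<in>C. (x, y) \<in> r \<or> (y, x) \<in> r \<or> x = y)"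
  by (auto simp: pred_on.chain_def)

lemma finite_has_maximum:
  fixes f :: "'b \<Rightarrow> nat"
  assumes "finite C" "C \<noteq> {}"
  obtains G where "G \<in> C" "\<And>F. F \<in> C \<Longrightarrow> f F \<le> f G"
proof -
  have "Max (f ` C) \<in> f ` C" using assms by simp
  then obtain G where "G \<in> C" "Max (f ` C) = f G" by auto
  moreover have "f F \<le> Max (f ` C)" if "F \<in> C" for F using assms that by simp
  ultimately show ?thesis using that by simp
qed

text \<open>
  The faces of a flagged poset can be listed flag by flag. Here \<open>x\<close> is a code of a flag and \<open>face x i\<close>
  its face of rank \<open>i - 1\<close>, so that indices start with the least element; different codes may describe
  the same flag. The last condition makes the union of the chains transitive: two flags through a
  common face can be exchanged above that face.
\<close>

locale flag_system =
  fixes N :: nat and X :: "'x set" and face :: "'x \<Rightarrow> nat \<Rightarrow> 'a"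
  assumes nonempty: "X \<noteq> {}"
    and finite_faces: "finite (\<Union>x\<in>X. face x ` {..N + 1})"
    and bottom: "x \<in> X \<Longrightarrow> y \<in> X \<Longrightarrow> face x 0 = face y 0"
    and top: "x \<in> X \<Longrightarrow> y \<in> X \<Longrightarrow> face x (N + 1) = face y (N + 1)"
    and index_unique:
      "x \<in> X \<Longrightarrow> y \<in> X \<Longrightarrow> i \<le> N + 1 \<Longrightarrow> j \<le> N + 1 \<Longrightarrow> face x i = face y j \<Longrightarrow> i = j"
    and splice: "x \<in> X \<Longrightarrow> y \<in> X \<Longrightarrow> j \<le> N + 1 \<Longrightarrow> face x j = face y j \<Longrightarrow>
      \<exists>z\<in>X. (\<forall>i\<le>j. face z i = face x i) \<and> (\<forall>i. j \<le> i \<and> i \<le> N + 1 \<longrightarrow> face z i = face y i)"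
begin

definition ord :: "'a rel" where
  "ord = {(face x i, face x j) | x i j. x \<in> X \<and> i \<le> j \<and> j \<le> N + 1}"

definition flag :: "'x \<Rightarrow> 'a set" where
  "flag x = face x ` {..N + 1}"

lemma Field_ord: "Field ord = (\<Union>x\<in>X. flag x)"
proof
  show "Field ord \<subseteq> (\<Union>x\<in>X. flag x)"
    by (auto simp: Field_def ord_def flag_def)
  show "(\<Union>x\<in>X. flag x) \<subseteq> Field ord"
  proof
    fix F assume "F \<in> (\<Union>x\<in>X. flag x)"
    then obtain x i where "x \<in> X" "i \<le> N + 1" "F = face x i"
      by (auto simp: flag_def)
    then have "(F, F) \<in> ord"
      by (auto simp: ord_def)
    then show "F \<in> Field ord"
      by (auto simp: Field_def)
  qed
qed

lemma finite_Field: "finite (Field ord)"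
  using finite_faces by (simp add: Field_ord flag_def)

lemma face_in_Field: "x \<in> X \<Longrightarrow> i \<le> N + 1 \<Longrightarrow> face x i \<in> Field ord"
  by (auto simp: Field_ord flag_def)

lemma ord_index:
  assumes "(face x i, face y j) \<in> ord" "x \<in> X" "y \<in> X" "i \<le> N + 1" "j \<le> N + 1"
  shows "i \<le> j"
proof -
  obtain z i' j' where z: "z \<in> X" "i' \<le> j'" "j' \<le> N + 1" "face x i = face z i'" "face y j = face z j'"
    using assms(1) by (auto simp: ord_def)
  then show ?thesis
    using index_unique[of x z i i'] index_unique[of y z j j'] assms by simp
qed

lemma ord_face_iff: "x \<in> X \<Longrightarrow> i \<le> N + 1 \<Longrightarrow> j \<le> N + 1 \<Longrightarrow> (face x i, face x j) \<in> ord \<longleftrightarrow> i \<le> j"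
  using ord_index[of x i x j] by (auto simp: ord_def)

lemma card_flag: "x \<in> X \<Longrightarrow> k \<le> N + 1 \<Longrightarrow> card (face x ` {..k}) = k + 1"
  by (subst card_image) (auto intro!: inj_onI index_unique[of x x])

lemma Partial_order_ord: "Partial_order ord"
proof -
  have "(F, F) \<in> ord" if "F \<in> Field ord" for F
    using that unfolding Field_ord by (auto simp: flag_def ord_def)
  moreover have "trans ord"
  proof (rule transI)
    fix F G H assume "(F, G) \<in> ord" "(G, H) \<in> ord"
    then obtain x y i j j' k where x: "x \<in> X" "i \<le> j" "j \<le> N + 1" "F = face x i" "G = face x j"
      and y: "y \<in> X" "j' \<le> k" "k \<le> N + 1" "G = face y j'" "H = face y k"
      by (auto simp: ord_def)
    have "j = j'"
      using x y by (intro index_unique[of x y]) auto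
    with x y splice[of x y j] obtain z where "z \<in> X" "face z i = F" "face z k = H"
      by auto
    with x y \<open>j = j'\<close> show "(F, H) \<in> ord"
      using ord_face_iff[of z i k] by simp
  qed
  moreover have "antisym ord"
  proof (rule antisymI)
    fix F G assume FG: "(F, G) \<in> ord" and GF: "(G, F) \<in> ord"
    from FG obtain x i j where x: "x \<in> X" "i \<le> j" "j \<le> N + 1" "F = face x i" "G = face x j"
      by (auto simp: ord_def)
    then have "j \<le> i"
      using GF ord_index[of x j x i] by simp
    with x show "F = G" by simp
  qed
  moreover have "ord \<subseteq> Field ord \<times> Field ord"
    by (auto simp: Field_def)
  ultimately show ?thesis
    by (auto simp: partial_order_on_def preorder_on_def refl_on_def)
qed

text \<open>
  Induction on the chain: the largest element \<open>G\<close> and its predecessor \<open>F\<close> lie in some flag because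
  they are comparable, and this flag can be spliced at \<open>F\<close> with a flag that contains the rest.
\<close>

lemma chain_in_flag:
  assumes "finite C" "C \<subseteq> Field ord" "\<And>F G. F \<in> C \<Longrightarrow> G \<in> C \<Longrightarrow> (F, G) \<in> ord \<or> (G, F) \<in> ord"
  shows "\<exists>x\<in>X. C \<subseteq> flag x"
  using assms
proof (induction "card C" arbitrary: C)
  case 0
  then show ?case using nonempty by auto
next
  case (Suc m)
  define idx where "idx F = (THE i. \<exists>x\<in>X. i \<le> N + 1 \<and> F = face x i)" for F
  have idx: "idx (face x i) = i" if "x \<in> X" "i \<le> N + 1" for x i
    unfolding idx_def using that by (intro the_equality) (auto dest: index_unique)
  have "C \<noteq> {}" using Suc.hyps by auto
  then obtain G where G: "G \<in> C" "\<And>F. F \<in> C \<Longrightarrow> idx F \<le> idx G"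
    using finite_has_maximum[of C idx] Suc.prems(1) by blast
  have le_G: "(F, G) \<in> ord" if F: "F \<in> C" for F
  proof -
    obtain x i where x: "x \<in> X" "i \<le> N + 1" "F = face x i"
      using F Suc.prems(2) by (auto simp: Field_ord flag_def)
    obtain y j where y: "y \<in> X" "j \<le> N + 1" "G = face y j"
      using G Suc.prems(2) by (auto simp: Field_ord flag_def)
    have "i \<le> j" using G(2)[OF F] idx x y by simp
    show ?thesis
    proof (cases "(F, G) \<in> ord")
      case False
      then have "(G, F) \<in> ord" using Suc.prems(3) F G by blast
      then have "j \<le> i" using ord_index x y by blast
      then obtain z i' j' where z: "z \<in> X" "i' \<le> j'" "j' \<le> N + 1" "G = face z i'" "F = face z j'"
        using \<open>(G, F) \<in> ord\<close> by (auto simp: ord_def)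
      then have "i' = j" "j' = i"
        using x y index_unique[of z y i' j] index_unique[of z x j' i] by auto
      then have "F = G" using z \<open>i \<le> j\<close> \<open>j \<le> i\<close> by simp
      then show ?thesis using x by (auto simp: ord_def)
    qed simp
  qed
  have "card (C - {G}) = m" using Suc G by simp
  then obtain x where x: "x \<in> X" "C - {G} \<subseteq> flag x"
    using Suc.hyps(1)[of "C - {G}"] Suc.prems by blast
  show ?case
  proof (cases "C - {G} = {}")
    case True
    then have "C = {G}" using G by blast
    then show ?thesis using Suc.prems(2) by (auto simp: Field_ord)
  next
    case False
    then obtain F where F: "F \<in> C - {G}" "\<And>H. H \<in> C - {G} \<Longrightarrow> idx H \<le> idx F"
      using finite_has_maximum[of "C - {G}" idx] Suc.prems(1) by blast
    then obtain k where k: "k \<le> N + 1" "F = face x k" using x by (auto simp: flag_def)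
    obtain y i j where y: "y \<in> X" "i \<le> j" "j \<le> N + 1" "F = face y i" "G = face y j"
      using le_G[of F] F by (auto simp: ord_def)
    have "i = k" using y k x by (intro index_unique[of y x]) auto
    then obtain z where z: "z \<in> X" "\<forall>i\<le>k. face z i = face x i"
        "\<forall>i. k \<le> i \<and> i \<le> N + 1 \<longrightarrow> face z i = face y i"
      using splice[of x y k] x y k by auto
    have "H \<in> flag z" if H: "H \<in> C" for H
    proof (cases "H = G")
      case True
      then show ?thesis using y z \<open>i = k\<close> by (auto simp: flag_def intro!: image_eqI[of _ _ j])
    next
      case False
      then obtain h where h: "h \<le> N + 1" "H = face x h" using H x by (auto simp: flag_def)
      have "h \<le> k" using F(2)[of H] H False idx x k h by simp
      then show ?thesis using z h by (auto simp: flag_def intro!: image_eqI[of _ _ h])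
    qed
    then show ?thesis using z by blast
  qed
qed

lemma flag_subset_eq:
  assumes "x \<in> X" "y \<in> X" "flag x \<subseteq> flag y" "i \<le> N + 1"
  shows "face x i = face y i"
proof -
  have "face x i \<in> flag y" using assms by (auto simp: flag_def)
  then obtain j where "j \<le> N + 1" "face x i = face y j" by (auto simp: flag_def)
  then show ?thesis using index_unique[of x y i j] assms by simp
qed

lemma flag_eq_iff: "x \<in> X \<Longrightarrow> y \<in> X \<Longrightarrow> flag x = flag y \<longleftrightarrow> (\<forall>i\<le>N+1. face x i = face y i)"
  using flag_subset_eq[of x y] by (auto simp: flag_def)

lemma chain_finite_in_flag:
  assumes "pred_on.chain (Field ord) (\<lambda>x y. (x, y) \<in> ord) C"
  shows "\<exists>x\<in>X. C \<subseteq> flag x"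
proof (rule chain_in_flag)
  show "C \<subseteq> Field ord" "finite C"
    using assms finite_subset[OF _ finite_Field] by (auto simp: set_chain_iff)
  then show "(F, G) \<in> ord \<or> (G, F) \<in> ord" if "F \<in> C" "G \<in> C" for F G
    using that assms Partial_order_ord
    unfolding set_chain_iff partial_order_on_def preorder_on_def refl_on_def by blast
qed

lemma chain_flag:
  assumes "x \<in> X" "C \<subseteq> flag x"
  shows "pred_on.chain (Field ord) (\<lambda>x y. (x, y) \<in> ord) C"
proof -
  have "(F, G) \<in> ord \<or> (G, F) \<in> ord" if "F \<in> flag x" "G \<in> flag x" for F G
    using that assms ord_face_iff[of x] by (auto simp: flag_def)
  then show ?thesis
    using assms unfolding set_chain_iff unfolding Field_ord by blast
qed

lemma flags_ord: "flags ord = flag ` X"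
proof
  show "flags ord \<subseteq> flag ` X"
  proof
    fix C assume "C \<in> flags ord"
    then have C: "pred_on.chain (Field ord) (\<lambda>x y. (x, y) \<in> ord) C"
      "\<And>S. pred_on.chain (Field ord) (\<lambda>x y. (x, y) \<in> ord) S \<Longrightarrow> \<not> C \<subset> S"
      by (auto simp: flags_def pred_on.maxchain_def)
    then obtain x where "x \<in> X" "C \<subseteq> flag x"
      using chain_finite_in_flag by blast
    then show "C \<in> flag ` X"
      using C(2) chain_flag by blast
  qed
  show "flag ` X \<subseteq> flags ord"
  proof
    fix C assume "C \<in> flag ` X"
    then obtain x where x: "x \<in> X" "C = flag x" by blast
    have "\<not> flag x \<subset> S" if "pred_on.chain (Field ord) (\<lambda>x y. (x, y) \<in> ord) S" for S
    proof
      assume "flag x \<subset> S"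
      moreover obtain y where y: "y \<in> X" "S \<subseteq> flag y"
        using chain_finite_in_flag \<open>pred_on.chain _ _ S\<close> by blast
      ultimately have "flag x = flag y"
        using flag_eq_iff[of x y] flag_subset_eq[of x y] x by auto
      then show False using y \<open>flag x \<subset> S\<close> by blast
    qed
    then show "C \<in> flags ord"
      using x chain_flag[of x "flag x"] by (auto simp: flags_def pred_on.maxchain_def)
  qed
qed

lemma flagged_poset_ord: "flagged_poset N ord"
proof -
  obtain x0 where x0: "x0 \<in> X" using nonempty by blast
  have "\<forall>F\<in>Field ord. (face x0 0, F) \<in> ord" "\<forall>F\<in>Field ord. (F, face x0 (N + 1)) \<in> ord"
    using bottom[OF x0] top[OF x0] ord_face_iff by (auto simp: Field_ord flag_def)
  moreover have "face x0 0 \<in> Field ord" "face x0 (N + 1) \<in> Field ord"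
    using face_in_Field x0 by simp_all
  ultimately show ?thesis
    using Partial_order_ord card_flag[of _ "N + 1"]
    unfolding flagged_poset_def flags_ord by (auto simp: flag_def)
qed

text \<open>
  The faces of a flag up to a given one form the maximal chains that determine its rank.
\<close>

lemma chain_to_in_initial:
  assumes "chain_to ord (face x k) C" "x \<in> X" "k \<le> N + 1"
  shows "\<exists>y\<in>X. face y k = face x k \<and> C \<subseteq> face y ` {..k}"
proof -
  obtain y where y: "y \<in> X" "C \<subseteq> flag y"
    using assms chain_finite_in_flag unfolding chain_to_def by blast
  then obtain j where "j \<le> N + 1" "face x k = face y j"
    using assms by (auto simp: chain_to_def flag_def)
  then have j: "face y k = face x k"
    using index_unique[of x y k j] assms y by simp
  have "F \<in> face y ` {..k}" if F: "F \<in> C" for F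
  proof -
    obtain i where "i \<le> N + 1" "F = face y i" using F y by (auto simp: flag_def)
    moreover have "(F, face y k) \<in> ord" using F assms j by (auto simp: chain_to_def)
    ultimately show ?thesis using ord_face_iff[of y i k] y assms by auto
  qed
  then show ?thesis using y j by blast
qed

lemma chain_to_initial: "x \<in> X \<Longrightarrow> k \<le> N + 1 \<Longrightarrow> chain_to ord (face x k) (face x ` {..k})"
  using chain_flag[of x "face x ` {..k}"] ord_face_iff[of x]
  by (auto simp: chain_to_def flag_def image_mono)

lemma rank_face:
  assumes "x \<in> X" "k \<le> N + 1"
  shows "rank ord (face x k) = int k - 1"
  unfolding rank_def
proof (rule the_equality)
  have card: "card C = k + 1" if C: "maxchain_to ord (face x k) C" for C
  proof -
    obtain y where y: "y \<in> X" "face y k = face x k" "C \<subseteq> face y ` {..k}"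
      using chain_to_in_initial[of x k C] C assms unfolding maxchain_to_def by blast
    then have "C = face y ` {..k}"
      using C chain_to_initial[of y k] assms by (auto simp: maxchain_to_def)
    then show ?thesis using card_flag y assms by simp
  qed
  then show "\<forall>C. maxchain_to ord (face x k) C \<longrightarrow> int (card C) = int k - 1 + 2"
    by auto
  have "maxchain_to ord (face x k) (face x ` {..k})"
    unfolding maxchain_to_def
  proof (intro conjI notI)
    show "chain_to ord (face x k) (face x ` {..k})" using chain_to_initial assms by blast
    assume "\<exists>D. chain_to ord (face x k) D \<and> face x ` {..k} \<subset> D"
    then obtain D y where D: "face x ` {..k} \<subset> D" "y \<in> X" "D \<subseteq> face y ` {..k}"
      using chain_to_in_initial assms by metis
    then have "card (face x ` {..k}) < card (face y ` {..k})"
      by (intro psubset_card_mono) auto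
    then show False using card_flag D assms by simp
  qed
  then show "k' = int k - 1" if "\<forall>C. maxchain_to ord (face x k) C \<longrightarrow> int (card C) = k' + 2" for k'
    using that card by fastforce
qed

lemma face_at_flag:
  assumes "x \<in> X"
  shows "face_at ord k (flag x) = (if -1 \<le> k \<and> k \<le> int N then {face x (nat (k + 1))} else {})"
proof -
  have "F \<in> face_at ord k (flag x) \<longleftrightarrow> -1 \<le> k \<and> k \<le> int N \<and> F = face x (nat (k + 1))" for F
  proof
    assume "F \<in> face_at ord k (flag x)"
    then obtain i where "i \<le> N + 1" "F = face x i" "rank ord F = k"
      by (auto simp: face_at_def flag_def)
    then show "-1 \<le> k \<and> k \<le> int N \<and> F = face x (nat (k + 1))"
      using rank_face[of x i] assms by auto
  next
    assume "-1 \<le> k \<and> k \<le> int N \<and> F = face x (nat (k + 1))"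
    then show "F \<in> face_at ord k (flag x)"
      using rank_face[of x "nat (k + 1)"] assms by (auto simp: face_at_def flag_def)
  qed
  then show ?thesis by auto
qed

lemma face_at_eq_iff:
  assumes "x \<in> X" "y \<in> X" "i \<le> N"
  shows "face_at ord (int i) (flag x) = face_at ord (int i) (flag y) \<longleftrightarrow> face x (Suc i) = face y (Suc i)"
  using assms by (simp add: face_at_flag nat_add_distrib)

lemma adjacent_iff:
  assumes "x \<in> X" "y \<in> X" "i < N"
  shows "adjacent ord i (flag x) (flag y) \<longleftrightarrow> (\<forall>j\<le>N+1. face x j \<noteq> face y j \<longleftrightarrow> j = Suc i)"
proof
  assume adj: "adjacent ord i (flag x) (flag y)"
  show "\<forall>j\<le>N+1. face x j \<noteq> face y j \<longleftrightarrow> j = Suc i"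
  proof (intro allI impI)
    fix j assume "j \<le> N + 1"
    then show "face x j \<noteq> face y j \<longleftrightarrow> j = Suc i"
      using adj[unfolded adjacent_def, THEN conjunct2, THEN conjunct2, rule_format, of "int j - 1"] assms
      by (auto simp: face_at_flag)
  qed
next
  assume r: "\<forall>j\<le>N+1. face x j \<noteq> face y j \<longleftrightarrow> j = Suc i"
  have "face_at ord j (flag x) \<noteq> face_at ord j (flag y) \<longleftrightarrow> j = int i" for j
  proof (cases "-1 \<le> j \<and> j \<le> int N")
    case True
    then have "nat (j + 1) \<le> N + 1" "nat (j + 1) = Suc i \<longleftrightarrow> j = int i" by linarith+
    then show ?thesis
      using r[rule_format, of "nat (j + 1)"] assms True by (simp add: face_at_flag)
  qed (use assms in \<open>auto simp: face_at_flag\<close>)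
  then show "adjacent ord i (flag x) (flag y)"
    using assms by (auto simp: adjacent_def flags_ord)
qed

end

text \<open>
  The diamond condition in terms of codes: exactly one other flag agrees with a given one except at
  rank \<open>k\<close>, and \<open>adj k\<close> produces a code of it.
\<close>

locale diamond_flag_system = flag_system N X face
  for N :: nat and X :: "'x set" and face :: "'x \<Rightarrow> nat \<Rightarrow> 'a" +
  fixes adj :: "nat \<Rightarrow> 'x \<Rightarrow> 'x"
  assumes adj_closed: "x \<in> X \<Longrightarrow> k < N \<Longrightarrow> adj k x \<in> X"
    and adj_differs: "x \<in> X \<Longrightarrow> k < N \<Longrightarrow> j \<le> N + 1 \<Longrightarrow> face (adj k x) j \<noteq> face x j \<longleftrightarrow> j = Suc k"
    and adj_only: "x \<in> X \<Longrightarrow> y \<in> X \<Longrightarrow> k < N \<Longrightarrow>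
      (\<And>j. j \<le> N + 1 \<Longrightarrow> j \<noteq> Suc k \<Longrightarrow> face y j = face x j) \<Longrightarrow>
      face y (Suc k) \<in> {face x (Suc k), face (adj k x) (Suc k)}"
begin

lemma adj_unique:
  assumes "x \<in> X" "y \<in> X" "k < N" "\<And>j. j \<le> N + 1 \<Longrightarrow> face y j \<noteq> face x j \<longleftrightarrow> j = Suc k"
  shows "flag y = flag (adj k x)"
proof -
  have "face y j = face (adj k x) j" if "j \<le> N + 1" for j
  proof (cases "j = Suc k")
    case True
    have "face y (Suc k) \<in> {face x (Suc k), face (adj k x) (Suc k)}"
      using assms by (intro adj_only) auto
    then show ?thesis
      using assms(4)[of j] True that by auto
  next
    case False
    then show ?thesis
      using assms(4)[of j] adj_differs[of x k j] assms that by auto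
  qed
  then show ?thesis by (auto simp: flag_def)
qed

lemma adjacent_adj:
  assumes "x \<in> X" "k < N"
  shows "adjacent ord k (flag x) \<Psi> \<longleftrightarrow> \<Psi> = flag (adj k x)"
proof
  assume adj: "adjacent ord k (flag x) \<Psi>"
  then obtain y where y: "y \<in> X" "\<Psi> = flag y"
    by (auto simp: adjacent_def flags_ord)
  then show "\<Psi> = flag (adj k x)"
    using adj adjacent_iff[of x y k] adj_unique[of x y k] assms by metis
next
  assume "\<Psi> = flag (adj k x)"
  then show "adjacent ord k (flag x) \<Psi>"
    using adjacent_iff[of x "adj k x" k] adj_differs[of x k] adj_closed assms by metis
qed

lemma flag_adj_cong:
  assumes "x \<in> X" "y \<in> X" "k < N" "flag x = flag y"
  shows "flag (adj k x) = flag (adj k y)"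
  using adjacent_adj[of x k] adjacent_adj[of y k] assms by auto

text \<open>
  Splicing three flags turns any face between \<open>F\<close> and \<open>G\<close> into a face of a flag that otherwise
  agrees with a given flag through \<open>F\<close> and \<open>G\<close>.
\<close>

lemma diamond_condition_ord: "diamond_condition ord"
  unfolding diamond_condition_def
proof (intro allI impI, elim conjE)
  fix F G assume FG: "(F, G) \<in> ord" "F \<noteq> G" "rank ord G - rank ord F = 2"
  then obtain x i j where x: "x \<in> X" "i \<le> j" "j \<le> N + 1" "F = face x i" "G = face x j"
    by (auto simp: ord_def)
  then have j: "j = Suc (Suc i)" and i: "i < N"
    using FG(3) rank_face[of x i] rank_face[of x j] by auto
  let ?y = "adj i x"
  have y: "?y \<in> X" "face ?y i = F" "face ?y j = G" "face ?y (Suc i) \<noteq> face x (Suc i)"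
    using adj_closed adj_differs[of x i i] adj_differs[of x i j] adj_differs[of x i "Suc i"] x i j by auto
  have mid: "(F, face z (Suc i)) \<in> ord \<and> F \<noteq> face z (Suc i) \<and> (face z (Suc i), G) \<in> ord \<and> face z (Suc i) \<noteq> G"
    if "z \<in> X" "face z i = F" "face z j = G" for z
  proof (intro conjI notI)
    show "(F, face z (Suc i)) \<in> ord" "(face z (Suc i), G) \<in> ord"
      using ord_face_iff[of z i "Suc i"] ord_face_iff[of z "Suc i" j] that i j by simp_all
    show False if "F = face z (Suc i)"
      using that index_unique[of z z i "Suc i"] \<open>z \<in> X\<close> \<open>face z i = F\<close> i by simp
    show False if "face z (Suc i) = G"
      using that index_unique[of z z "Suc i" j] \<open>z \<in> X\<close> \<open>face z j = G\<close> i j by simp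
  qed
  have "H = face x (Suc i) \<or> H = face ?y (Suc i)"
    if H: "(F, H) \<in> ord" "F \<noteq> H" "(H, G) \<in> ord" "H \<noteq> G" for H
  proof -
    obtain y a b where y: "y \<in> X" "a \<le> b" "b \<le> N + 1" "F = face y a" "H = face y b"
      using H by (auto simp: ord_def)
    obtain z c d where z: "z \<in> X" "c \<le> d" "d \<le> N + 1" "H = face z c" "G = face z d"
      using H by (auto simp: ord_def)
    have "a = i" using x y j by (intro index_unique[of y x]) auto
    moreover have "d = j" using x z j by (intro index_unique[of z x]) auto
    moreover have "c = b" using y z by (intro index_unique[of z y]) auto
    moreover have "a \<noteq> b" "c \<noteq> d" using H y z by auto
    ultimately have bc: "b = Suc i" "c = Suc i" "a = i" "d = j" using y z j by auto
    obtain u where u: "u \<in> X" "\<forall>k\<le>i. face u k = face x k" "\<forall>k. i \<le> k \<and> k \<le> N + 1 \<longrightarrow> face u k = face y k"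
      using splice[of x y i] x y i bc by auto
    then have "face u (Suc i) = H" using y bc i by simp
    then obtain v where v: "v \<in> X" "\<forall>k\<le>Suc i. face v k = face u k"
        "\<forall>k. Suc i \<le> k \<and> k \<le> N + 1 \<longrightarrow> face v k = face z k"
      using splice[of u z "Suc i"] u z i bc by auto
    then have "face v j = G" using z bc j i by simp
    then obtain t where t: "t \<in> X" "\<forall>k\<le>j. face t k = face v k"
        "\<forall>k. j \<le> k \<and> k \<le> N + 1 \<longrightarrow> face t k = face x k"
      using splice[of v x j] v x i j by auto
    have "face t k = face x k" if "k \<le> N + 1" "k \<noteq> Suc i" for k
      using that t v u j by (cases "k \<le> i") auto
    then have "face t (Suc i) \<in> {face x (Suc i), face ?y (Suc i)}"
      using adj_only[of x t i] t x i by auto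
    moreover have "face t (Suc i) = H"
      using t v \<open>face u (Suc i) = H\<close> j by simp
    ultimately show ?thesis by auto
  qed
  moreover have "(F, H) \<in> ord \<and> F \<noteq> H \<and> (H, G) \<in> ord \<and> H \<noteq> G"
    if "H = face x (Suc i) \<or> H = face ?y (Suc i)" for H
    using that mid[of x] mid[of ?y] x(1,4,5) y(1-3) by metis
  ultimately have "{H. (F, H) \<in> ord \<and> F \<noteq> H \<and> (H, G) \<in> ord \<and> H \<noteq> G} = {face x (Suc i), face ?y (Suc i)}"
    by auto
  then show "card {H. (F, H) \<in> ord \<and> F \<noteq> H \<and> (H, G) \<in> ord \<and> H \<noteq> G} = 2"
    using y by simp
qed

lemma abstract_polytope_ord:
  assumes "\<And>x y. x \<in> X \<Longrightarrow> y \<in> X \<Longrightarrow> \<exists>z. flag z = flag y \<and>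
    (\<lambda>u v. \<exists>k<N. v = adj k u \<and> face x (Suc k) \<noteq> face y (Suc k))\<^sup>*\<^sup>* x z"
  shows "abstract_polytope N ord"
proof -
  have "strongly_flag_connected N ord"
    unfolding strongly_flag_connected_def
  proof (intro ballI)
    fix \<Phi> \<Psi> assume "\<Phi> \<in> flags ord" "\<Psi> \<in> flags ord"
    then obtain x y where x: "x \<in> X" "\<Phi> = flag x" and y: "y \<in> X" "\<Psi> = flag y"
      by (auto simp: flags_ord)
    let ?R = "\<lambda>S T. \<exists>i<N. adjacent ord i S T \<and> face_at ord (int i) \<Phi> \<noteq> face_at ord (int i) \<Psi>"
    obtain z where z: "flag z = flag y"
      "(\<lambda>u v. \<exists>k<N. v = adj k u \<and> face x (Suc k) \<noteq> face y (Suc k))\<^sup>*\<^sup>* x z"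
      using assms x y by blast
    from z(2) have "z \<in> X \<and> ?R\<^sup>*\<^sup>* (flag x) (flag z)"
    proof (induction rule: rtranclp_induct)
      case (step u v)
      then obtain k where k: "k < N" "v = adj k u" "face x (Suc k) \<noteq> face y (Suc k)" by blast
      then have "?R (flag u) (flag v)"
        using adjacent_adj[of u k] face_at_eq_iff[of x y k] step x y by auto
      then show ?case
        using step.IH k adj_closed rtranclp.rtrancl_into_rtrancl[of ?R "flag x" "flag u" "flag v"] by blast
    qed (use x in simp)
    then show "?R\<^sup>*\<^sup>* \<Phi> \<Psi>" using x y z by simp
  qed
  then show ?thesis
    using finite_Field flagged_poset_ord diamond_condition_ord by (simp add: abstract_polytope_def)
qed

text \<open>
  The image of a flag is a maximal chain, hence a flag, and the index of a face in it is the number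
  of smaller faces, which an automorphism preserves.
\<close>

lemma automorphism_face:
  assumes f: "poset_automorphism ord f" and x: "x \<in> X"
  obtains y where "y \<in> X" "\<And>i. i \<le> N + 1 \<Longrightarrow> f (face x i) = face y i"
proof -
  have inj: "inj_on f (Field ord)" and maps: "f ` Field ord = Field ord"
    using f by (auto simp: poset_automorphism_def bij_betw_def)
  have iff: "(f F, f G) \<in> ord \<longleftrightarrow> (F, G) \<in> ord" if "F \<in> Field ord" "G \<in> Field ord" for F G
    using f that by (auto simp: poset_automorphism_def)
  have sub: "flag x \<subseteq> Field ord" using x by (auto simp: Field_ord)
  have "pred_on.chain (Field ord) (\<lambda>x y. (x, y) \<in> ord) (f ` flag x)"
    using chain_flag[of x "flag x"] x maps sub iff unfolding set_chain_iff by blast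
  then obtain y where y: "y \<in> X" "f ` flag x \<subseteq> flag y"
    using chain_finite_in_flag by blast
  have "card (f ` flag x) = card (flag y)"
    using card_flag[of x "N + 1"] card_flag[of y "N + 1"] inj_on_subset[OF inj sub] x y
    by (simp add: card_image flag_def)
  then have eq: "f ` flag x = flag y"
    using y by (intro card_subset_eq) (auto simp: flag_def)
  have "f (face x i) = face y i" if i: "i \<le> N + 1" for i
  proof -
    have "f (face x i) \<in> flag y" using eq i by (auto simp: flag_def)
    then obtain t where t: "t \<le> N + 1" "f (face x i) = face y t" by (auto simp: flag_def)
    have below: "{F \<in> flag z. (F, face z j) \<in> ord} = face z ` {..j}" if "z \<in> X" "j \<le> N + 1" for z j
      using ord_face_iff[of z _ j] that by (auto simp: flag_def)
    have "f ` {F \<in> flag x. (F, face x i) \<in> ord} = {F \<in> flag y. (F, face y t) \<in> ord}"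
      unfolding eq[symmetric] t(2)[symmetric] using iff sub face_in_Field[OF x i] by blast
    then have "card (f ` (face x ` {..i})) = card (face y ` {..t})"
      using below x y i t by simp
    moreover have "face x ` {..i} \<subseteq> Field ord" using sub i by (auto simp: flag_def)
    ultimately have "i = t"
      using card_image[OF inj_on_subset[OF inj]] card_flag x y i t by simp
    then show ?thesis using t by simp
  qed
  then show ?thesis using that y by blast
qed

lemma automorphism_adj:
  assumes f: "poset_automorphism ord f" and "x \<in> X" "y \<in> X" "f ` flag x = flag y" "k < N"
  shows "f ` flag (adj k x) = flag (adj k y)"
proof -
  have inj: "inj_on f (Field ord)"
    using f by (auto simp: poset_automorphism_def bij_betw_def)
  obtain y' where y': "y' \<in> X" "\<And>i. i \<le> N + 1 \<Longrightarrow> f (face x i) = face y' i"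
    using automorphism_face[OF f \<open>x \<in> X\<close>] by blast
  then have "f ` flag x = flag y'" by (auto simp: flag_def image_image)
  obtain z where z: "z \<in> X" "\<And>i. i \<le> N + 1 \<Longrightarrow> f (face (adj k x) i) = face z i"
    using automorphism_face[OF f adj_closed] assms by blast
  have "flag z = flag (adj k y')"
  proof (rule adj_unique)
    fix j assume j: "j \<le> N + 1"
    have "face z j = face y' j \<longleftrightarrow> face (adj k x) j = face x j"
      using inj_on_eq_iff[OF inj] face_in_Field[OF _ j] adj_closed y' z j assms by metis
    then show "face z j \<noteq> face y' j \<longleftrightarrow> j = Suc k"
      using adj_differs[of x k j] j assms by simp
  qed (use y' z assms in auto)
  moreover have "f ` flag (adj k x) = flag z" using z by (auto simp: flag_def image_image)
  ultimately show ?thesis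
    using flag_adj_cong[of y' y k] \<open>f ` flag x = flag y'\<close> y' assms by simp
qed

text \<open>
  The map on faces is well defined and injective because the map on codes preserves and reflects
  equality of faces.
\<close>

lemma automorphism_of_flag_map:
  assumes maps: "\<And>x. x \<in> X \<Longrightarrow> \<phi> x \<in> X"
    and cong: "\<And>x y i. x \<in> X \<Longrightarrow> y \<in> X \<Longrightarrow> i \<le> N + 1 \<Longrightarrow>
      face (\<phi> x) i = face (\<phi> y) i \<longleftrightarrow> face x i = face y i"
  obtains f where "poset_automorphism ord f" "\<And>x. x \<in> X \<Longrightarrow> f ` flag x = flag (\<phi> x)"
proof -
  define f where "f F = (SOME G. \<exists>x i. x \<in> X \<and> i \<le> N + 1 \<and> F = face x i \<and> G = face (\<phi> x) i)" for F
  have f: "f (face x i) = face (\<phi> x) i" if "x \<in> X" "i \<le> N + 1" for x i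
  proof -
    have "\<exists>y j. y \<in> X \<and> j \<le> N + 1 \<and> face x i = face y j \<and> f (face x i) = face (\<phi> y) j"
      unfolding f_def by (rule someI[of _ "face (\<phi> x) i"]) (use that in blast)
    then show ?thesis using cong that index_unique by metis
  qed
  have finite_ord: "finite ord"
    by (rule finite_subset[of _ "Field ord \<times> Field ord"])
      (auto intro: FieldI1 FieldI2 simp: finite_Field)
  have maps_f: "f ` Field ord \<subseteq> Field ord"
    using f maps face_in_Field by (auto simp: Field_ord flag_def)
  have inj: "inj_on f (Field ord)"
  proof (rule inj_onI)
    fix F G assume "F \<in> Field ord" "G \<in> Field ord" "f F = f G"
    then obtain x i y j where "x \<in> X" "i \<le> N + 1" "F = face x i" "y \<in> X" "j \<le> N + 1" "G = face y j"
      "face (\<phi> x) i = face (\<phi> y) j"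
      using f by (auto simp: Field_ord flag_def)
    then show "F = G" using index_unique[of "\<phi> x" "\<phi> y" i j] maps cong by metis
  qed
  have mono: "(f F, f G) \<in> ord" if "(F, G) \<in> ord" for F G
    using that f maps by (auto simp: ord_def) (metis (no_types, lifting) le_trans)
  \<comment> \<open>The order is a finite set of pairs, so an injective map of it into itself is onto.\<close>
  have "inj_on (map_prod f f) ord"
    using inj by (intro inj_onI) (auto intro: inj_onD[OF inj] FieldI1 FieldI2)
  then have onto: "map_prod f f ` ord = ord"
    using mono finite_ord by (intro endo_inj_surj) auto
  have "(F, G) \<in> ord" if FG: "F \<in> Field ord" "G \<in> Field ord" "(f F, f G) \<in> ord" for F G
  proof -
    have "(f F, f G) \<in> map_prod f f ` ord" using FG(3) onto by simp
    then obtain F' G' where "(F', G') \<in> ord" "f F' = f F" "f G' = f G" by auto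
    moreover from this have "F' \<in> Field ord" "G' \<in> Field ord" by (auto simp: Field_def)
    ultimately show ?thesis using inj_onD[OF inj] FG by metis
  qed
  then have "poset_automorphism ord f"
    using mono inj endo_inj_surj[OF finite_Field maps_f inj]
    by (auto simp: poset_automorphism_def bij_betw_def)
  moreover have "f ` flag x = flag (\<phi> x)" if "x \<in> X" for x
    using f that by (auto simp: flag_def image_image)
  ultimately show ?thesis using that by blast
qed

text \<open>
  An automorphism commutes with adjacency and is thus determined by the image of one flag.
\<close>

lemma automorphism_eq_flag_map:
  assumes f: "poset_automorphism ord f" and x: "x \<in> X" "f ` flag x = flag (\<phi> x)"
    and maps: "\<And>x. x \<in> X \<Longrightarrow> \<phi> x \<in> X"
    and comm: "\<And>x k. x \<in> X \<Longrightarrow> k < N \<Longrightarrow> flag (\<phi> (adj k x)) = flag (adj k (\<phi> x))"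
    and path: "(\<lambda>u v. \<exists>k<N. v = adj k u)\<^sup>*\<^sup>* x z"
  shows "f ` flag z = flag (\<phi> z)"
proof -
  from path have "z \<in> X \<and> f ` flag z = flag (\<phi> z)"
  proof (induction rule: rtranclp_induct)
    case (step u v)
    then show ?case
      using automorphism_adj[OF f, of u "\<phi> u"] adj_closed maps comm by metis
  qed (use x in simp)
  then show ?thesis ..
qed

text \<open>
  If a two-valued invariant \<open>p\<close> of flags separates exactly the orbits, then the symmetry type graph can
  be read off from the ranks at which adjacency changes \<open>p\<close>.
\<close>

lemma symmetry_type_graph_two_vertex:
  fixes p :: "'x \<Rightarrow> bool"
  assumes I: "I \<subset> {..<N}"
    and p_flag: "\<And>x y. x \<in> X \<Longrightarrow> y \<in> X \<Longrightarrow> flag x = flag y \<Longrightarrow> p x = p y"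
    and p_adj: "\<And>x k. x \<in> X \<Longrightarrow> k < N \<Longrightarrow> p (adj k x) = (if k \<in> I then p x else \<not> p x)"
    and p_inv: "\<And>f x y. poset_automorphism ord f \<Longrightarrow> x \<in> X \<Longrightarrow> y \<in> X \<Longrightarrow> f ` flag x = flag y \<Longrightarrow> p x = p y"
    and p_trans: "\<And>x y. x \<in> X \<Longrightarrow> y \<in> X \<Longrightarrow> p x = p y \<Longrightarrow> \<exists>f. poset_automorphism ord f \<and> f ` flag x = flag y"
  shows "isomorphic (symmetry_type_graph N ord) (two_vertex N I)"
proof -
  define orb where "orb b = {flag y | y. y \<in> X \<and> p y = b}" for b
  have orb: "flag_orbit ord (flag x) = orb (p x)" if x: "x \<in> X" for x
  proof
    show "flag_orbit ord (flag x) \<subseteq> orb (p x)"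
    proof
      fix \<Psi> assume "\<Psi> \<in> flag_orbit ord (flag x)"
      then obtain f where f: "poset_automorphism ord f" "\<Psi> = f ` flag x"
        by (auto simp: flag_orbit_def)
      obtain y where "y \<in> X" "\<And>i. i \<le> N + 1 \<Longrightarrow> f (face x i) = face y i"
        using automorphism_face[OF f(1) x] by blast
      moreover from this have "f ` flag x = flag y" by (auto simp: flag_def image_image)
      ultimately show "\<Psi> \<in> orb (p x)"
        using p_inv[OF f(1) x] f by (auto simp: orb_def)
    qed
    show "orb (p x) \<subseteq> flag_orbit ord (flag x)"
      using p_trans[OF x] by (fastforce simp: orb_def flag_orbit_def)
  qed
  obtain k where k: "k < N" "k \<notin> I" using I by auto
  obtain x0 where x0: "x0 \<in> X" using nonempty by blast
  have attained: "\<exists>x\<in>X. p x = b" for b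
    using x0 p_adj[OF x0 k(1)] adj_closed[OF x0 k(1)] k(2) by metis
  have inj: "inj orb"
  proof (rule injI)
    fix b c assume "orb b = orb c"
    moreover obtain x where x: "x \<in> X" "p x = b" using attained by blast
    ultimately have "flag x \<in> orb c" unfolding orb_def by blast
    then obtain y where "y \<in> X" "p y = c" "flag x = flag y" unfolding orb_def by blast
    then show "b = c" using p_flag[of x y] x by simp
  qed
  have "p ` X = UNIV" using attained by blast
  have "vertices (symmetry_type_graph N ord) = (\<lambda>x. flag_orbit ord (flag x)) ` X"
    by (simp add: symmetry_type_graph_def flag_graph_def flags_ord image_image)
  also have "\<dots> = (\<lambda>x. orb (p x)) ` X" using orb by simp
  also have "\<dots> = orb ` p ` X" by (simp only: image_image)
  finally have verts: "vertices (symmetry_type_graph N ord) = orb ` UNIV"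
    using \<open>p ` X = UNIV\<close> by simp
  have edges: "edges (symmetry_type_graph N ord) = (\<lambda>(i, e). (i, orb ` e)) ` edges (two_vertex N I)"
    (is "?L = ?R")
  proof
    show "?L \<subseteq> ?R"
    proof
      fix a assume "a \<in> ?L"
      then obtain i \<Phi> \<Psi> where a: "a = (i, {flag_orbit ord \<Phi>, flag_orbit ord \<Psi>})"
        and i: "i < N" "adjacent ord i \<Phi> \<Psi>"
        by (auto simp: symmetry_type_graph_def flag_graph_def)
      then obtain x where x: "x \<in> X" "\<Phi> = flag x" by (auto simp: adjacent_def flags_ord)
      then have "\<Psi> = flag (adj i x)" using adjacent_adj i by simp
      then have a': "a = (i, orb ` {p x, p (adj i x)})"
        using a orb x i adj_closed by simp
      have "(i, {p x, p (adj i x)}) \<in> edges (two_vertex N I)"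
        using p_adj[of x i] x i by (cases "p x") (auto simp: two_vertex_def)
      then show "a \<in> ?R" using a' by force
    qed
    show "?R \<subseteq> ?L"
    proof
      fix a assume "a \<in> ?R"
      then obtain i e where e: "(i, e) \<in> edges (two_vertex N I)" "a = (i, orb ` e)" by auto
      then have i: "i < N" using I by (auto simp: two_vertex_def)
      have "\<exists>b. e = {b, if i \<in> I then b else \<not> b}"
      proof (cases "i \<in> I")
        case True
        then show ?thesis using e(1) by (auto simp: two_vertex_def)
      next
        case False
        then have "e = {False, True}" using e(1) by (auto simp: two_vertex_def)
        then show ?thesis using False by (intro exI[of _ False]) simp
      qed
      then obtain b where b: "e = {b, if i \<in> I then b else \<not> b}" ..
      obtain x where x: "x \<in> X" "p x = b" using attained by blast
      then have "(i, {flag x, flag (adj i x)}) \<in> edges (flag_graph N ord)"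
        using adjacent_adj[of x i "flag (adj i x)"] i by (auto simp: flag_graph_def)
      then have "(i, flag_orbit ord ` {flag x, flag (adj i x)}) \<in> ?L"
        by (force simp: symmetry_type_graph_def)
      moreover have "flag_orbit ord ` {flag x, flag (adj i x)} = orb ` e"
        using orb x i adj_closed p_adj b by simp
      ultimately show "a \<in> ?L" using e by simp
    qed
  qed
  let ?\<phi> = "inv orb"
  have "(\<lambda>(i, e). (i, ?\<phi> ` e)) ((\<lambda>(i, e). (i, orb ` e)) a) = a" for a :: "nat \<times> bool set"
    using inj by (cases a) (simp add: image_image)
  then have "(\<lambda>(i, e). (i, ?\<phi> ` e)) ` (\<lambda>(i, e). (i, orb ` e)) ` E = E" for E :: "(nat \<times> bool set) set"
    unfolding image_image by simp
  moreover have "bij_betw ?\<phi> (orb ` UNIV) UNIV"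
    using inj by (metis bij_betw_imageI bij_betw_inv_into)
  moreover have "vertices (two_vertex N I) = UNIV"
    by (simp add: two_vertex_def)
  ultimately show ?thesis
    unfolding isomorphic_def verts edges by (intro exI[of _ ?\<phi>]) simp
qed

end

section \<open>Adjacent transpositions of lists\<close>

text \<open>
  A list is the order in which the coordinates become free in a flag. Exchanging the entries at
  positions \<open>k - 1\<close> and \<open>k\<close> changes just the \<open>k\<close>-th initial segment, as a set.
\<close>

definition swap :: "nat \<Rightarrow> 'b list \<Rightarrow> 'b list" where
  "swap k l = take (k - 1) l @ l ! k # l ! (k - 1) # drop (k + 1) l"

lemma swap_append: "k = Suc (length ys) \<Longrightarrow> swap k (ys @ a # b # zs) = ys @ b # a # zs"
  by (simp add: swap_def nth_append)

lemma two_entries_split: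
  assumes "0 < k" "k < length l"
  obtains ys a b zs where "l = ys @ a # b # zs" "k = Suc (length ys)"
proof -
  have eq: "l = take (k - 1) l @ l ! (k - 1) # l ! k # drop (k + 1) l"
    using assms id_take_nth_drop[of "k - 1" l] Cons_nth_drop_Suc[of k l] by simp
  then show ?thesis by (rule that) (use assms in simp)
qed

lemma set_take_swap:
  assumes "0 < k" "k < length l" "j \<noteq> k"
  shows "set (take j (swap k l)) = set (take j l)"
proof -
  obtain ys a b zs where l: "l = ys @ a # b # zs" "k = Suc (length ys)"
    using two_entries_split assms by blast
  show ?thesis
  proof (cases "j \<le> length ys")
    case False
    then have "Suc (Suc (length ys)) \<le> j" using assms l by simp
    then obtain m where "j = Suc (Suc (length ys)) + m" using le_Suc_ex by blast
    then have "j - length ys = Suc (Suc m)" by simp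
    then show ?thesis using l by (auto simp: swap_append)
  qed (use l in \<open>simp add: swap_append\<close>)
qed

lemma set_swap: "0 < k \<Longrightarrow> k < length l \<Longrightarrow> set (swap k l) = set l"
  by (erule (1) two_entries_split) (auto simp: swap_append)

lemma distinct_swap: "0 < k \<Longrightarrow> k < length l \<Longrightarrow> distinct (swap k l) \<longleftrightarrow> distinct l"
  by (erule (1) two_entries_split) (auto simp: swap_append)

lemma length_swap: "0 < k \<Longrightarrow> k < length l \<Longrightarrow> length (swap k l) = length l"
  by (erule (1) two_entries_split) (auto simp: swap_append)

lemma swap_swap: "0 < k \<Longrightarrow> k < length l \<Longrightarrow> swap k (swap k l) = l"
  by (erule (1) two_entries_split) (auto simp: swap_append)

lemma map_swap: "0 < k \<Longrightarrow> k < length l \<Longrightarrow> map f (swap k l) = swap k (map f l)"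
  by (erule (1) two_entries_split) (auto simp: swap_append)

definition swap_step :: "nat set \<Rightarrow> 'b list \<Rightarrow> 'b list \<Rightarrow> bool" where
  "swap_step K l l' \<longleftrightarrow> (\<exists>k. 0 < k \<and> k < length l \<and> k \<notin> K \<and> l' = swap k l)"

lemma symp_swap_step: "symp (swap_step K)"
proof (rule sympI)
  fix l l' :: "'a list" assume "swap_step K l l'"
  then obtain k where "0 < k" "k < length l" "k \<notin> K" "l' = swap k l"
    by (auto simp: swap_step_def)
  then show "swap_step K l' l"
    unfolding swap_step_def by (intro exI[of _ k]) (simp add: length_swap swap_swap)
qed

lemma swap_steps_sym: "(swap_step K)\<^sup>*\<^sup>* l l' \<Longrightarrow> (swap_step K)\<^sup>*\<^sup>* l' l"
  by (rule sympD[OF symp_rtranclp[OF symp_swap_step]])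

lemma swap_steps_set_take:
  assumes "(swap_step K)\<^sup>*\<^sup>* l l'" "k \<in> K"
  shows "set (take k l') = set (take k l)"
  using assms(1)
proof (induction rule: rtranclp_induct)
  case (step l1 l2)
  then obtain j where "0 < j" "j < length l1" "j \<notin> K" "l2 = swap j l1"
    unfolding swap_step_def by blast
  moreover have "k \<noteq> j" using assms(2) \<open>j \<notin> K\<close> by blast
  ultimately show ?case using set_take_swap[of j l1 k] step.IH by simp
qed simp

lemma move_entry_forward:
  assumes "\<And>k. k \<in> K \<Longrightarrow> k \<le> length as \<or> k > length as + length ys"
  shows "(swap_step K)\<^sup>*\<^sup>* (as @ ys @ x # zs) (as @ x # ys @ zs)"
  using assms
proof (induction ys arbitrary: zs rule: rev_induct)
  case (snoc y ys)
  let ?k = "Suc (length (as @ ys))"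
  have "?k \<notin> K" using snoc.prems[of ?k] by auto
  then have "swap_step K (as @ (ys @ [y]) @ x # zs) (as @ ys @ x # y # zs)"
    unfolding swap_step_def by (intro exI[of _ ?k]) (simp add: swap_append[of _ "as @ ys", simplified])
  moreover have "(swap_step K)\<^sup>*\<^sup>* (as @ ys @ x # y # zs) (as @ x # ys @ y # zs)"
    using snoc.prems by (intro snoc.IH) force
  ultimately show ?case by (simp add: converse_rtranclp_into_rtranclp)
qed simp

text \<open>
  Strong connectivity for orders of the coordinates. The entry that comes first in the target is
  moved forward; this crosses no position \<open>k \<in> K\<close>, as otherwise the \<open>k\<close>-th initial segments would
  differ in that entry. Then the rest of the list is treated in the same way.
\<close>

lemma swap_steps_connect:
  assumes "distinct l" "distinct l'" "set l = set l'"
    "\<And>k. k \<in> K \<Longrightarrow> set (take k l) = set (take k l')"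
  shows "(swap_step K)\<^sup>*\<^sup>* l l'"
proof -
  have "(swap_step K)\<^sup>*\<^sup>* (as @ r) (as @ r')"
    if "distinct (as @ r)" "distinct (as @ r')" "set r = set r'"
      "\<And>k. k \<in> K \<Longrightarrow> set (take k (as @ r)) = set (take k (as @ r'))" for as r r' :: "'a list"
    using that
  proof (induction r' arbitrary: as r)
    case (Cons x r')
    then obtain ys zs where r: "r = ys @ x # zs"
      by (metis list.set_intros(1) split_list)
    have K: "k \<le> length as \<or> k > length as + length ys" if k: "k \<in> K" for k
    proof (rule ccontr)
      assume "\<not> ?thesis"
      then have k': "length as < k" "k \<le> length as + length ys" by auto
      then have "x \<in> set (take k (as @ x # r'))" by (cases "k - length as") auto
      moreover have "x \<notin> set (take k (as @ r))"
        using Cons.prems(1) r k' by (auto dest: in_set_takeD)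
      ultimately show False using Cons.prems(4)[OF k] by blast
    qed
    have steps: "(swap_step K)\<^sup>*\<^sup>* (as @ r) (as @ x # ys @ zs)"
      unfolding r using K by (rule move_entry_forward)
    have "(swap_step K)\<^sup>*\<^sup>* ((as @ [x]) @ ys @ zs) ((as @ [x]) @ r')"
    proof (rule Cons.IH)
      show "set (ys @ zs) = set r'"
        using Cons.prems(1-3) r by auto
      show "set (take k ((as @ [x]) @ ys @ zs)) = set (take k ((as @ [x]) @ r'))" if "k \<in> K" for k
        using swap_steps_set_take[OF steps that] Cons.prems(4)[OF that] by simp
    qed (use Cons.prems r in auto)
    with steps show ?case by simp
  qed simp
  from this[of "[]"] show ?thesis using assms by simp
qed


section \<open>Gluing cubes along their facets\<close>

lemma even_card_sym_diff:
  assumes "finite A" "finite B"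
  shows "even (card (sym_diff A B)) \<longleftrightarrow> even (card A + card B)"
proof -
  have "card A = card (A - B) + card (A \<inter> B)" "card B = card (B - A) + card (A \<inter> B)"
    using assms by (metis add.commute card_Diff_subset_Int finite_Int card_Int_Diff inf_commute)+
  moreover have "card (sym_diff A B) = card (A - B) + card (B - A)"
    using assms by (intro card_Un_disjoint) auto
  ultimately have "card A + card B = card (sym_diff A B) + 2 * card (A \<inter> B)" by simp
  then show ?thesis by simp
qed

text \<open>
  The letter \<open>(j, e)\<close> stands for the facet of the cube on which the \<open>j\<close>-th coordinate has the value \<open>e\<close>.
\<close>

definition letters :: "nat \<Rightarrow> (nat \<times> bool) set" where
  "letters n = {..<n} \<times> UNIV"

definition words :: "nat \<Rightarrow> (nat \<times> bool) list set" where
  "words n = lists (letters n)"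

lemma words_simps [simp]:
  "[] \<in> words n" "c # w \<in> words n \<longleftrightarrow> c \<in> letters n \<and> w \<in> words n"
  "v @ w \<in> words n \<longleftrightarrow> v \<in> words n \<and> w \<in> words n" "rev w \<in> words n \<longleftrightarrow> w \<in> words n"
  by (auto simp: words_def)

text \<open>A letter permutation: a signed permutation of the coordinates.\<close>

text \<open>
  The action on facets of the symmetry of the cube that permutes the coordinates by \<open>\<pi>\<close> and then
  flips those in \<open>D\<close>.
\<close>

definition signed_perm :: "(nat \<Rightarrow> nat) \<Rightarrow> nat set \<Rightarrow> nat \<times> bool \<Rightarrow> nat \<times> bool" where
  "signed_perm \<pi> D c = (\<pi> (fst c), snd c \<noteq> (\<pi> (fst c) \<in> D))"

text \<open>
  Words with the same state describe the same cube. A vertex of the cube is the set \<open>E\<close> of coordinates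
  with value one, and \<open>cell w E A\<close> is the face with free coordinates \<open>A\<close> of the cube \<open>w\<close> at that
  vertex. Parity of the length excludes fixed points of letters and, later, gives the invariant that
  separates the flag orbits.
\<close>

locale cube_gluing =
  fixes n :: nat and state :: "(nat \<times> bool) list \<Rightarrow> 's"
    and cell :: "(nat \<times> bool) list \<Rightarrow> nat set \<Rightarrow> nat set \<Rightarrow> 'a" and bot top :: 'a
  assumes n_ge_2: "2 \<le> n"
    and state_append: "w \<in> words n \<Longrightarrow> w' \<in> words n \<Longrightarrow> u \<in> words n \<Longrightarrow> state w = state w' \<Longrightarrow>
      state (w @ u) = state (w' @ u)"
    and state_cancel: "w \<in> words n \<Longrightarrow> c \<in> letters n \<Longrightarrow> state (w @ [c, c]) = state w"
    and state_parity: "w \<in> words n \<Longrightarrow> w' \<in> words n \<Longrightarrow> state w = state w' \<Longrightarrow>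
      even (length w) \<longleftrightarrow> even (length w')"
    and cell_eq_iff: "w \<in> words n \<Longrightarrow> w' \<in> words n \<Longrightarrow> E \<subseteq> {..<n} \<Longrightarrow> E' \<subseteq> {..<n} \<Longrightarrow>
      A \<subseteq> {..<n} \<Longrightarrow> A' \<subseteq> {..<n} \<Longrightarrow> cell w E A = cell w' E' A' \<longleftrightarrow>
      A = A' \<and> E - A = E' - A \<and> (\<exists>u\<in>lists {(j, j \<in> E) | j. j < n \<and> j \<notin> A}. state (w @ u) = state w')"
    and bot_neq_top: "bot \<noteq> top"
    and cell_neq_bot: "cell w E A \<noteq> bot"
    and cell_neq_top: "cell w E A \<noteq> top"
    and finite_cells: "finite {cell w E A | w E A. w \<in> words n \<and> E \<subseteq> {..<n} \<and> A \<subseteq> {..<n}}"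
begin

text \<open>
  The facets of the cube that contain the face at the vertex \<open>E\<close> with free coordinates \<open>A\<close>: crossing one
  of them leads to another cube with the same face.
\<close>

definition avail :: "nat set \<Rightarrow> nat set \<Rightarrow> (nat \<times> bool) set" where
  "avail E A = {(j, j \<in> E) | j. j < n \<and> j \<notin> A}"

lemma avail_words: "u \<in> lists (avail E A) \<Longrightarrow> u \<in> words n"
  by (auto simp: avail_def words_def letters_def in_lists_conv_set)

lemma avail_antimono: "A \<subseteq> B \<Longrightarrow> lists (avail E B) \<subseteq> lists (avail E A)"
  by (intro lists_mono) (auto simp: avail_def)

lemma avail_UNIV: "avail E {..<n} = {}"
  by (auto simp: avail_def)

lemma cell_eqD:
  assumes "cell w E A = cell w' E' A'" "w \<in> words n" "w' \<in> words n" "E \<subseteq> {..<n}" "E' \<subseteq> {..<n}"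
    "A \<subseteq> {..<n}" "A' \<subseteq> {..<n}"
  obtains u where "A = A'" "E - A = E' - A" "u \<in> lists (avail E A)" "state (w @ u) = state w'"
  using assms that by (auto simp: cell_eq_iff avail_def)

lemma cell_eqI:
  assumes "u \<in> lists (avail E A)" "state (w @ u) = state w'" "E - A = E' - A" "w \<in> words n" "w' \<in> words n"
    "E \<subseteq> {..<n}" "E' \<subseteq> {..<n}" "A \<subseteq> {..<n}"
  shows "cell w E A = cell w' E' A"
  using assms unfolding avail_def by (subst cell_eq_iff) blast+

lemma cell_cong:
  assumes "state w = state w'" "E - A = E' - A" "w \<in> words n" "w' \<in> words n"
    "E \<subseteq> {..<n}" "E' \<subseteq> {..<n}" "A \<subseteq> {..<n}"
  shows "cell w E A = cell w' E' A"
  using assms by (intro cell_eqI[of "[]"]) auto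

lemma state_cancel_word: "w \<in> words n \<Longrightarrow> u \<in> words n \<Longrightarrow> state (w @ rev u @ u) = state w"
proof (induction u arbitrary: w)
  case (Cons c u)
  have "state ((w @ rev u @ [c, c]) @ u) = state ((w @ rev u) @ u)"
    using Cons.prems state_cancel[of "w @ rev u" c] by (intro state_append) auto
  then show ?case using Cons by simp
qed simp

lemma state_cancel_word': "w \<in> words n \<Longrightarrow> u \<in> words n \<Longrightarrow> state (w @ u @ rev u) = state w"
  using state_cancel_word[of w "rev u"] by simp

definition X :: "((nat \<times> bool) list \<times> nat set \<times> nat list) set" where
  "X = {(w, E, l). w \<in> words n \<and> E \<subseteq> {..<n} \<and> distinct l \<and> set l = {..<n}}"

fun face :: "(nat \<times> bool) list \<times> nat set \<times> nat list \<Rightarrow> nat \<Rightarrow> 'a" where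
  "face (w, E, l) k =
     (if k = 0 then bot else if k = n + 2 then top else cell w E (set (take (k - 1) l)))"

text \<open>
  All coordinates except the last one of \<open>l\<close> are free in the face of rank \<open>n - 1\<close>, so the cube on its
  other side is reached by the letter of that coordinate.
\<close>

fun adj :: "nat \<Rightarrow> (nat \<times> bool) list \<times> nat set \<times> nat list
    \<Rightarrow> (nat \<times> bool) list \<times> nat set \<times> nat list" where
  "adj k (w, E, l) =
     (if k = 0 then (w, sym_diff E {hd l}, l)
      else if k = n then (w @ [(last l, last l \<in> E)], E, l)
      else (w, E, swap k l))"

lemma X_length: "(w, E, l) \<in> X \<Longrightarrow> length l = n"
  by (auto simp: X_def dest: distinct_card)

lemma X_take: "(w, E, l) \<in> X \<Longrightarrow> set (take k l) \<subseteq> {..<n}"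
  using set_take_subset[of k l] by (auto simp: X_def)

lemma X_card_take: "(w, E, l) \<in> X \<Longrightarrow> k \<le> n \<Longrightarrow> card (set (take k l)) = k"
  using X_length[of w E l] distinct_card[of "take k l"] by (auto simp: X_def)

lemma X_take_n: "(w, E, l) \<in> X \<Longrightarrow> set (take n l) = {..<n}"
  using X_length[of w E l] by (auto simp: X_def)

lemma X_take_butlast: "(w, E, l) \<in> X \<Longrightarrow> set (take (n - 1) l) = {..<n} - {last l}"
  using X_length[of w E l] n_ge_2
  by (cases l rule: rev_cases) (auto simp: X_def)

lemma X_hd: "(w, E, l) \<in> X \<Longrightarrow> hd l < n \<and> (0 < k \<longrightarrow> hd l \<in> set (take k l)) \<and> set (take 1 l) = {hd l}"
  using X_length[of w E l] n_ge_2 by (cases l; cases k) (auto simp: X_def)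

lemma X_last: "(w, E, l) \<in> X \<Longrightarrow> last l < n \<and> (k < n \<longrightarrow> last l \<notin> set (take k l))"
  using X_length[of w E l] n_ge_2
  by (cases l rule: rev_cases) (auto simp: X_def dest: in_set_takeD)

lemma face_eqD:
  assumes "face (w, E, l) (Suc k) = face (w', E', l') (Suc k)" "(w, E, l) \<in> X" "(w', E', l') \<in> X" "k \<le> n"
  obtains u where "set (take k l) = set (take k l')" "E - set (take k l) = E' - set (take k l)"
    "u \<in> lists (avail E (set (take k l)))" "state (w @ u) = state w'"
  by (rule cell_eqD[of w E "set (take k l)" w' E' "set (take k l')"])
    (use assms X_take[OF assms(2)] X_take[OF assms(3)] that in \<open>auto simp: X_def\<close>)

text \<open>
  To splice two flags at a common cell, take the cube of the upper flag and the vertex of the lower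
  one. The lower cells do not notice the change of cube, because the letters that connect the two
  cubes avoid the larger set \<open>A\<close> of free coordinates, and the upper cells do not notice the change of
  vertex, because it is confined to \<open>A\<close>.
\<close>

sublocale flag_system "n + 1" X face
proof
  show "X \<noteq> {}"
  proof -
    have "([], {}, [0..<n]) \<in> X" by (auto simp: X_def)
    then show ?thesis by blast
  qed
  have "(\<Union>x\<in>X. face x ` {..n + 1 + 1}) \<subseteq>
      {bot, top} \<union> {cell w E A | w E A. w \<in> words n \<and> E \<subseteq> {..<n} \<and> A \<subseteq> {..<n}}"
    using X_take by (fastforce simp: X_def split: if_splits)
  then show "finite (\<Union>x\<in>X. face x ` {..n + 1 + 1})"
    by (rule finite_subset) (use finite_cells in simp)
  show "face x 0 = face y 0" "face x (n + 1 + 1) = face y (n + 1 + 1)" for x y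
    by (cases x; cases y; simp)+
  show "i = j" if xy: "x \<in> X" "y \<in> X" "i \<le> n + 1 + 1" "j \<le> n + 1 + 1" "face x i = face y j" for x y i j
  proof -
    obtain w E l w' E' l' where x: "x = (w, E, l)" "y = (w', E', l')" by (metis prod_cases3)
    show ?thesis
    proof (cases "0 < i \<and> i < n + 2 \<and> 0 < j \<and> j < n + 2")
      case True
      then have eq: "cell w E (set (take (i - 1) l)) = cell w' E' (set (take (j - 1) l'))"
        using xy x by auto
      have "set (take (i - 1) l) \<subseteq> {..<n}" "set (take (j - 1) l') \<subseteq> {..<n}"
        using X_take xy x by blast+
      moreover have "w \<in> words n" "w' \<in> words n" "E \<subseteq> {..<n}" "E' \<subseteq> {..<n}"
        using xy x by (auto simp: X_def)
      ultimately have "set (take (i - 1) l) = set (take (j - 1) l')"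
        using eq cell_eq_iff[of w w' E E' "set (take (i - 1) l)" "set (take (j - 1) l')"] by simp
      moreover have "i - 1 \<le> n" "j - 1 \<le> n" using True by linarith+
      ultimately have "i - 1 = j - 1"
        using X_card_take[of w E l "i - 1"] X_card_take[of w' E' l' "j - 1"] xy x True by simp
      then show ?thesis using True by linarith
    next
      case False
      then show ?thesis
        using xy x bot_neq_top cell_neq_bot cell_neq_top
        cell_neq_bot[symmetric] cell_neq_top[symmetric]
          by (auto split: if_splits)
    qed
  qed
  show "\<exists>z\<in>X. (\<forall>i\<le>j. face z i = face x i) \<and> (\<forall>i. j \<le> i \<and> i \<le> n + 1 + 1 \<longrightarrow> face z i = face y i)"
    if xy: "x \<in> X" "y \<in> X" "j \<le> n + 1 + 1" "face x j = face y j" for x y j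
  proof -
    obtain w E l w' E' l' where x: "x = (w, E, l)" "y = (w', E', l')" by (metis prod_cases3)
    consider "j = 0" | "j = n + 2" | k where "j = Suc k" "k \<le> n" using xy(3) by (cases j) fastforce+
    then show ?thesis
    proof cases
      case 1
      then show ?thesis using xy x by (intro bexI[of _ y]) auto
    next
      case 2
      then show ?thesis using xy x by (intro bexI[of _ x]) auto
    next
      case (3 k)
      obtain u where u: "set (take k l) = set (take k l')" "E - set (take k l) = E' - set (take k l)"
        "u \<in> lists (avail E (set (take k l)))" "state (w @ u) = state w'"
        using face_eqD xy x 3 by metis
      let ?l = "take k l @ drop k l'"
      have len: "length l = n" "length l' = n" using X_length xy x by auto
      have "set (drop k l') = {..<n} - set (take k l')"
        using xy x set_append[of "take k l'" "drop k l'"] distinct_append[of "take k l'" "drop k l'"]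
        by (auto simp: X_def)
      then have z: "(w', E, ?l) \<in> X"
        using xy x u X_take[of w E l k] by (auto simp: X_def)
      have "face (w', E, ?l) i = face x i" if "i \<le> j" for i
      proof (cases "i = 0")
        case False
        have "i - 1 \<le> k" using that 3 by simp
        then have "take (i - 1) ?l = take (i - 1) l" using 3 len by (simp add: min_def)
        moreover have "cell w E (set (take (i - 1) l)) = cell w' E (set (take (i - 1) l))"
        proof (rule cell_eqI)
          have "set (take (i - 1) l) \<subseteq> set (take k l)" using that 3 by (intro set_take_subset_set_take) simp
          then show "u \<in> lists (avail E (set (take (i - 1) l)))" using u avail_antimono by blast
          show "set (take (i - 1) l) \<subseteq> {..<n}" using X_take xy x by blast
        qed (use u xy x in \<open>auto simp: X_def\<close>)
        ultimately show ?thesis using x by simp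
      qed (use x in simp)
      moreover have "face (w', E, ?l) i = face y i" if "j \<le> i" "i \<le> n + 1 + 1" for i
      proof (cases "i = n + 2")
        case False
        have "k \<le> i - 1" using that 3 by simp
        then have "set (take (i - 1) ?l) = set (take k l') \<union> set (take (i - 1 - k) (drop k l'))"
          using 3 len u(1) by (simp add: min.absorb2)
        also have "\<dots> = set (take k l' @ take (i - 1 - k) (drop k l'))" by simp
        also have "take k l' @ take (i - 1 - k) (drop k l') = take (i - 1) l'"
          using that 3 take_add[of k "i - 1 - k" l'] by simp
        finally have eq: "set (take (i - 1) ?l) = set (take (i - 1) l')" .
        have "set (take k l) \<subseteq> set (take (i - 1) l')"
          unfolding u using that 3 by (intro set_take_subset_set_take) simp
        moreover have "set (take (i - 1) l') \<subseteq> {..<n}" using X_take xy x by blast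
        ultimately have "cell w' E (set (take (i - 1) l')) = cell w' E' (set (take (i - 1) l'))"
          using u(2) xy x by (intro cell_cong) (auto simp: X_def)
        then show ?thesis using eq x that 3 False by simp
      qed (use x in simp)
      ultimately show ?thesis using z by blast
    qed
  qed
qed

lemma adj_in_X:
  assumes "x \<in> X" "k < n + 1"
  shows "adj k x \<in> X"
proof -
  obtain w E l where x: "x = (w, E, l)" by (metis prod_cases3)
  show ?thesis
    using assms x X_hd[of w E l 1] X_last[of w E l 0] X_length[of w E l] set_swap[of k l] distinct_swap[of k l]
    by (auto simp: X_def letters_def)
qed

lemma avail_insert_last:
  assumes "(w, E, l) \<in> X"
  shows "avail E (set (take (n - 1) l)) = {(last l, last l \<in> E)}"
  using X_take_butlast[OF assms] X_last[OF assms, of 0] by (auto simp: avail_def)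

lemma state_single_letter:
  "w \<in> words n \<Longrightarrow> c \<in> letters n \<Longrightarrow> u \<in> lists {c} \<Longrightarrow> state (w @ u) \<in> {state w, state (w @ [c])}"
proof (induction u arbitrary: w)
  case (Cons d u)
  then have "state ((w @ [c]) @ u) \<in> {state (w @ [c]), state ((w @ [c]) @ [c])}" by (intro Cons.IH) auto
  then show ?case using Cons.prems state_cancel[of w c] by auto
qed simp

text \<open>
  For the uniqueness of adjacent flags: at rank 0 the vertices can differ only in the first
  coordinate; at rank \<open>n\<close> the cubes are connected by words in a single letter, which acts as an
  involution; at the other ranks the cells are determined by their free coordinates, the cells
  of neighbouring rank being equal.
\<close>

sublocale diamond_flag_system "n + 1" X face adj
proof
  show "adj k x \<in> X" if "x \<in> X" "k < n + 1" for x k using adj_in_X that .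
  show "(face (adj k x) j \<noteq> face x j) = (j = Suc k)"
    if xk: "x \<in> X" "k < n + 1" "j \<le> n + 1 + 1" for x k j
  proof -
    obtain w E l where x: "x = (w, E, l)" by (metis prod_cases3)
    have wE: "w \<in> words n" "E \<subseteq> {..<n}" using xk x by (auto simp: X_def)
    consider "j = 0 \<or> j = n + 2" | i where "j = Suc i" "i \<le> n" using xk(3) by (cases j) fastforce+
    then show ?thesis
    proof cases
      case 1
      then show ?thesis using x xk by auto
    next
      case (2 i)
      let ?A = "set (take i l)"
      have A: "?A \<subseteq> {..<n}" using X_take xk x by blast
      consider (first) "k = 0" | (last) "k = n" | (mid) "0 < k" "k < n" using xk(2) by linarith
      then show ?thesis
      proof cases
        case first
        let ?h = "hd l"
        have h: "?h < n" "0 < i \<Longrightarrow> ?h \<in> ?A" using X_hd[of w E l i] xk x by auto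
        have "cell w (sym_diff E {?h}) ?A = cell w E ?A \<longleftrightarrow> sym_diff E {?h} - ?A = E - ?A"
          using cell_eq_iff[of w w "sym_diff E {?h}" E ?A ?A] wE A h by (force intro: bexI[of _ "[]"])
        also have "\<dots> \<longleftrightarrow> 0 < i" using h by (cases "i = 0") auto
        finally show ?thesis using x first 2 n_ge_2 by auto
      next
        case last
        let ?c = "(last l, last l \<in> E)"
        have c: "last l < n" "i < n \<Longrightarrow> last l \<notin> ?A" using X_last[of w E l i] xk x by auto
        have "cell w E ?A = cell (w @ [?c]) E ?A \<longleftrightarrow> i < n"
        proof
          assume i: "i < n"
          show "cell w E ?A = cell (w @ [?c]) E ?A"
            by (rule cell_eqI[of "[?c]"]) (use c wE A i in \<open>auto simp: avail_def letters_def\<close>)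
        next
          assume eq: "cell w E ?A = cell (w @ [?c]) E ?A"
          show "i < n"
          proof (rule ccontr)
            assume "\<not> i < n"
            then have "?A = {..<n}" using X_take_n[of w E l] xk x 2 by simp
            moreover obtain u where "u \<in> lists (avail E ?A)" "state (w @ u) = state (w @ [?c])"
              using cell_eqD[OF eq] c wE A by (auto simp: letters_def)
            ultimately have "state w = state (w @ [?c])" by (simp add: avail_UNIV)
            then show False using state_parity[of w "w @ [?c]"] wE c by (simp add: letters_def)
          qed
        qed
        then show ?thesis using x last 2 n_ge_2 by auto
      next
        case mid
        have len: "length l = n" using X_length xk x by blast
        have "adj k x \<in> X" using adj_in_X xk by blast
        then have swapX: "(w, E, swap k l) \<in> X" using x mid by simp
        let ?B = "set (take i (swap k l))"
        have "cell w E ?B = cell w E ?A \<longleftrightarrow> ?B = ?A"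
          using cell_eq_iff[of w w E E ?B ?A] wE A X_take[OF swapX] by auto
        also have "\<dots> \<longleftrightarrow> i \<noteq> k"
        proof (cases "i = k")
          case True
          obtain ys a b zs where l: "l = ys @ a # b # zs" "k = Suc (length ys)"
            using two_entries_split mid len by metis
          then show ?thesis using xk(1) x True by (auto simp: swap_append X_def)
        qed (use set_take_swap mid len in blast)
        finally show ?thesis using x mid 2 by auto
      qed
    qed
  qed
  show "face y (Suc k) \<in> {face x (Suc k), face (adj k x) (Suc k)}"
    if xk: "x \<in> X" "y \<in> X" "k < n + 1" and
      agree: "\<And>j. j \<le> n + 1 + 1 \<Longrightarrow> j \<noteq> Suc k \<Longrightarrow> face y j = face x j" for x y k
  proof -
    obtain w E l w' E' l' where x: "x = (w, E, l)" "y = (w', E', l')" by (metis prod_cases3)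
    have wE: "w \<in> words n" "E \<subseteq> {..<n}" "w' \<in> words n" "E' \<subseteq> {..<n}" using xk x by (auto simp: X_def)
    have agree': "face (w, E, l) (Suc i) = face (w', E', l') (Suc i)" if "i \<le> n" "i \<noteq> k" for i
      using agree[of "Suc i"] that x by simp
    consider (first) "k = 0" | (last) "k = n" | (mid) "0 < k" "k < n" using xk(3) by linarith
    then show ?thesis
    proof cases
      case first
      let ?h = "hd l"
      have h: "?h < n" "set (take 1 l) = {?h}" using X_hd[of w E l] xk x by auto
      have "face (w, E, l) (Suc 1) = face (w', E', l') (Suc 1)"
        using first n_ge_2 by (intro agree') auto
      moreover have "(w, E, l) \<in> X" "(w', E', l') \<in> X" "1 \<le> n" using xk x n_ge_2 by auto
      ultimately obtain u where "set (take 1 l) = set (take 1 l')" "E - set (take 1 l) = E' - set (take 1 l)"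
        "u \<in> lists (avail E (set (take 1 l)))" "state (w @ u) = state w'"
        by (rule face_eqD)
      then have u: "E - {?h} = E' - {?h}" "u \<in> lists (avail E {?h})" "state (w @ u) = state w'"
        unfolding h(2) by simp_all
      have "E' = E \<or> E' = sym_diff E {?h}" using u(1) by blast
      then show ?thesis
      proof
        assume "E' = E"
        moreover have "cell w E {} = cell w' E {}"
          using u wE avail_antimono[of "{}" "{?h}" E] by (intro cell_eqI[of u]) auto
        ultimately show ?thesis using x first by simp
      next
        assume E': "E' = sym_diff E {?h}"
        have "avail E {?h} \<subseteq> avail E' {}" unfolding E' by (auto simp: avail_def)
        then have "cell w E' {} = cell w' E' {}"
          using u wE lists_mono[of "avail E {?h}" "avail E' {}"] by (intro cell_eqI[of u]) auto
        then show ?thesis using x first E' n_ge_2 by simp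
      qed
    next
      case last
      let ?c = "(last l, last l \<in> E)"
      have c: "?c \<in> letters n" using X_last[of w E l 0] xk x by (simp add: letters_def)
      have "face (w, E, l) (Suc (n - 1)) = face (w', E', l') (Suc (n - 1))"
        using last n_ge_2 by (intro agree') auto
      moreover have "(w, E, l) \<in> X" "(w', E', l') \<in> X" "n - 1 \<le> n" using xk x n_ge_2 by auto
      ultimately obtain u where "set (take (n - 1) l) = set (take (n - 1) l')"
        "E - set (take (n - 1) l) = E' - set (take (n - 1) l)"
        "u \<in> lists (avail E (set (take (n - 1) l)))" "state (w @ u) = state w'"
        by (rule face_eqD)
      then have "state w' \<in> {state w, state (w @ [?c])}"
        using state_single_letter[of w ?c u] wE c avail_insert_last[of w E l] xk x by simp
      moreover have "cell v E {..<n} = cell w' E' {..<n}" if "state v = state w'" "v \<in> words n" for v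
        using that wE by (intro cell_cong) auto
      ultimately have "cell w' E' {..<n} \<in> {cell w E {..<n}, cell (w @ [?c]) E {..<n}}"
        using wE c by fastforce
      then show ?thesis using x last n_ge_2 X_take_n xk by auto
    next
      case mid
      have len: "length l = n" "length l' = n" using X_length xk x by auto
      obtain ys a b zs where l: "l = ys @ a # b # zs" "k = Suc (length ys)"
        using two_entries_split mid len by metis
      have dist: "distinct l" using xk x by (simp add: X_def)
      obtain ys' a' b' zs' where l': "l' = ys' @ a' # b' # zs'" "k = Suc (length ys')"
        using two_entries_split[of k l'] mid len by metis
      obtain u where u: "set (take (k - 1) l) = set (take (k - 1) l')"
        "E - set (take (k - 1) l) = E' - set (take (k - 1) l)"
        "u \<in> lists (avail E (set (take (k - 1) l)))" "state (w @ u) = state w'"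
        by (rule face_eqD[OF agree'[of "k - 1"]]) (use xk x mid in auto)
      obtain v where v: "set (take (k + 1) l) = set (take (k + 1) l')"
        "E - set (take (k + 1) l) = E' - set (take (k + 1) l)"
        "v \<in> lists (avail E (set (take (k + 1) l)))" "state (w @ v) = state w'"
        by (rule face_eqD[OF agree'[of "k + 1"]]) (use xk x mid in auto)
      have "distinct l'" using xk x by (simp add: X_def)
      then have "a' = a \<or> a' = b"
        using u(1) v(1) l l' by auto
      let ?B = "set (take k l')"
      have "?B = insert a' (set (take (k - 1) l'))" using l' by simp
      then have B: "?B = set (take k l) \<or> ?B = set (take k (swap k l))"
        using \<open>a' = a \<or> a' = b\<close> u(1) l by (auto simp: swap_append)
      have sub: "set (take (k - 1) l) \<subseteq> ?B" "?B \<subseteq> set (take (k + 1) l)"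
        unfolding u v by (rule set_take_subset_set_take, simp)+
      have "cell w E ?B = cell w' E' ?B"
      proof (rule cell_eqI)
        show "v \<in> lists (avail E ?B)" using v(3) avail_antimono[OF sub(2)] by blast
        show "E - ?B = E' - ?B" using u(2) sub(1) by blast
      qed (use wE v X_take xk x in auto)
      then show ?thesis using B x mid by auto
    qed
  qed
qed

text \<open>
  Sequences of adjacent flags that keep the faces with rank in \<open>K\<close>.
\<close>

definition walk :: "nat set \<Rightarrow> (nat \<times> bool) list \<times> nat set \<times> nat list \<Rightarrow>
    (nat \<times> bool) list \<times> nat set \<times> nat list \<Rightarrow> bool" where
  "walk K = (\<lambda>x y. \<exists>k<n + 1. k \<notin> K \<and> y = adj k x)\<^sup>*\<^sup>*"

lemma walk_trans: "walk K x y \<Longrightarrow> walk K y z \<Longrightarrow> walk K x z"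
  by (simp add: walk_def)

lemma walk_refl: "walk K x x"
  by (simp add: walk_def)

lemma walk_adj: "k < n + 1 \<Longrightarrow> k \<notin> K \<Longrightarrow> walk K x (adj k x)"
  unfolding walk_def by (rule r_into_rtranclp) blast

lemma walk_swap:
  assumes "(swap_step K)\<^sup>*\<^sup>* l l'" "length l = n"
  shows "walk K (w, E, l) (w, E, l')"
proof -
  have "length l' = n \<and> walk K (w, E, l) (w, E, l')"
    using assms
  proof (induction rule: rtranclp_induct)
    case (step l1 l2)
    then obtain k where k: "0 < k" "k < length l1" "k \<notin> K" "l2 = swap k l1"
      unfolding swap_step_def by blast
    then have "adj k (w, E, l1) = (w, E, l2)" using step by simp
    moreover have "walk K (w, E, l1) (adj k (w, E, l1))" using k step by (intro walk_adj) auto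
    ultimately have "walk K (w, E, l1) (w, E, l2)" by simp
    then show ?case
      using k step walk_trans[of K "(w, E, l)" "(w, E, l1)" "(w, E, l2)"] length_swap[of k l1] by simp
  qed (simp add: walk_refl)
  then show ?thesis ..
qed

text \<open>
  Move \<open>i\<close> to the front of the order, flip the coordinate by an adjacency of rank 0, and move it back.
  All ranks in \<open>K\<close> lie beyond the position of \<open>i\<close>, so none of them is used.
\<close>

lemma walk_flip:
  assumes "(w, E, l) \<in> X" "i < n" "\<And>k. k \<in> K \<Longrightarrow> i \<in> set (take k l)"
  shows "walk K (w, E, l) (w, sym_diff E {i}, l)"
proof -
  have len: "length l = n" using X_length assms by blast
  have "i \<in> set l" using assms by (auto simp: X_def)
  then obtain ys zs where l: "l = ys @ i # zs" by (metis split_list)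
  have dist: "distinct l" using assms by (simp add: X_def)
  have "k > length ys" if "k \<in> K" for k
  proof (rule ccontr)
    assume "\<not> k > length ys"
    then have "set (take k l) \<subseteq> set ys" using l by (auto dest: in_set_takeD)
    then show False using assms(3)[OF that] dist l by auto
  qed
  then have steps: "(swap_step K)\<^sup>*\<^sup>* l (i # ys @ zs)"
    using move_entry_forward[of K "[]" ys i zs] l by auto
  have "0 \<notin> K" using assms(3)[of 0] by auto
  then have "walk K (w, E, i # ys @ zs) (w, sym_diff E {i}, i # ys @ zs)"
    using walk_adj[of 0 K "(w, E, i # ys @ zs)"] by simp
  moreover have "walk K (w, F, l) (w, F, i # ys @ zs)" "walk K (w, F, i # ys @ zs) (w, F, l)" for F
    using walk_swap[OF steps] walk_swap[OF swap_steps_sym[OF steps]] len l by auto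
  ultimately show ?thesis using walk_trans by blast
qed

text \<open>
  Dually, move \<open>i\<close> to the end of the order and use an adjacency of rank \<open>n\<close>.
\<close>

lemma walk_letter:
  assumes "(w, E, l) \<in> X" "i < n" "K \<subseteq> {..n}" "\<And>k. k \<in> K \<Longrightarrow> i \<notin> set (take k l)"
  shows "walk K (w, E, l) (w @ [(i, i \<in> E)], E, l)"
proof -
  have len: "length l = n" using X_length assms by blast
  have "i \<in> set l" using assms by (auto simp: X_def)
  then obtain ys zs where l: "l = ys @ i # zs" by (metis split_list)
  have "k \<le> length ys" if "k \<in> K" for k
  proof (rule ccontr)
    assume "\<not> k \<le> length ys"
    then have "i \<in> set (take k l)" using l by (cases "k - length ys") auto
    then show False using assms(4)[OF that] by blast
  qed
  then have steps: "(swap_step K)\<^sup>*\<^sup>* l (ys @ zs @ [i])"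
    using swap_steps_sym[OF move_entry_forward[of K ys zs i "[]"]] l by auto
  have "n \<notin> K" using assms(4)[of n] X_take_n[OF assms(1)] assms(2) by auto
  then have "walk K (w, E, ys @ zs @ [i]) (w @ [(i, i \<in> E)], E, ys @ zs @ [i])"
    using walk_adj[of n K "(w, E, ys @ zs @ [i])"] n_ge_2 by simp
  moreover have "walk K (v, E, l) (v, E, ys @ zs @ [i])" "walk K (v, E, ys @ zs @ [i]) (v, E, l)" for v
    using walk_swap[OF steps] walk_swap[OF swap_steps_sym[OF steps]] len l by auto
  ultimately show ?thesis using walk_trans by blast
qed

lemma walk_flips:
  assumes "(w, E, l) \<in> X" "D \<subseteq> {..<n}" "\<And>i k. i \<in> D \<Longrightarrow> k \<in> K \<Longrightarrow> i \<in> set (take k l)"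
  shows "walk K (w, E, l) (w, sym_diff E D, l)"
proof -
  have "finite D" using assms(2) finite_subset by blast
  then show ?thesis
    using assms(2,3)
  proof (induction D rule: finite_induct)
    case (insert i D)
    have "(w, sym_diff E D, l) \<in> X" using insert.prems assms(1) by (auto simp: X_def)
    then have last: "walk K (w, sym_diff E D, l) (w, sym_diff (sym_diff E D) {i}, l)"
      using insert.prems by (intro walk_flip) blast+
    have eq: "sym_diff (sym_diff E D) {i} = sym_diff E (insert i D)"
      using insert.hyps by blast
    have "walk K (w, E, l) (w, sym_diff E D, l)"
      by (rule insert.IH) (use insert.prems in blast)+
    then show ?case using walk_trans last unfolding eq by blast
  qed (simp add: walk_refl)
qed

lemma walk_word:
  assumes "(w, E, l) \<in> X" "u \<in> words n" "K \<subseteq> {..n}"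
    "K = {} \<or> (\<forall>k\<in>K. u \<in> lists (avail E (set (take k l))))"
  shows "walk K (w, E, l) (w @ u, E, l)"
  using assms
proof (induction u rule: rev_induct)
  case (snoc c u)
  obtain i e where c: "c = (i, e)" by (cases c)
  have i: "i < n" using snoc.prems c by (auto simp: letters_def)
  have IH: "walk K (w, E, l) (w @ u, E, l)"
    using snoc.prems by (intro snoc.IH) auto
  have uX: "(w @ u, F, l) \<in> X" if "F \<subseteq> {..<n}" for F using that snoc.prems by (auto simp: X_def)
  have E: "E \<subseteq> {..<n}" using snoc.prems by (simp add: X_def)
  have "walk K (w @ u, E, l) (w @ u @ [c], E, l)"
  proof (cases "e = (i \<in> E)")
    case True
    have "walk K (w @ u, E, l) ((w @ u) @ [(i, i \<in> E)], E, l)"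
      using snoc.prems c by (intro walk_letter[OF uX[OF E] i]) (auto simp: avail_def)
    then show ?thesis using c True by simp
  next
    \<comment> \<open>If no face has to be kept, flip the coordinate, use the letter, and flip back.\<close>
    case False
    then have K: "K = {}" using snoc.prems(4) c by (auto simp: avail_def)
    let ?F = "sym_diff E {i}"
    have F: "?F \<subseteq> {..<n}" "sym_diff ?F {i} = E" using E i by auto
    have "walk K (w @ u, E, l) (w @ u, ?F, l)"
      using K by (intro walk_flip[OF uX[OF E] i]) auto
    moreover have "walk K (w @ u, ?F, l) (w @ u @ [c], ?F, l)"
    proof -
      have "(i, i \<in> ?F) = c" using False c by auto
      moreover have "walk K (w @ u, ?F, l) ((w @ u) @ [(i, i \<in> ?F)], ?F, l)"
        using K by (intro walk_letter[OF uX[OF F(1)] i]) auto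
      ultimately show ?thesis by simp
    qed
    moreover have "walk K (w @ u @ [c], ?F, l) (w @ u @ [c], E, l)"
    proof -
      have "(w @ u @ [c], ?F, l) \<in> X" using snoc.prems F(1) by (simp add: X_def)
      then show ?thesis using walk_flip[of "w @ u @ [c]" ?F l i K] K i F(2) by simp
    qed
    ultimately show ?thesis by (blast intro: walk_trans)
  qed
  with IH show ?case by (rule walk_trans)
qed (simp add: walk_refl)

text \<open>
  Two flags that share the cells with rank in \<open>K\<close> differ in three independent ways. Their orders have
  the same initial segments at \<open>K\<close>, their cubes are connected by letters of coordinates that are free
  in none of the common cells (read off from the largest of them), and their vertices differ only in
  coordinates that are free in all of them. Each difference can be removed without using ranks in \<open>K\<close>.
\<close>

lemma connected_away_from_common_faces:
  assumes x: "x \<in> X" and y: "y \<in> X"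
  shows "\<exists>z. flag z = flag y \<and> walk {k. k \<le> n \<and> face x (Suc k) = face y (Suc k)} x z"
proof -
  obtain w E l w' E' l' where xy: "x = (w, E, l)" "y = (w', E', l')" by (metis prod_cases3)
  define K where "K = {k. k \<le> n \<and> face x (Suc k) = face y (Suc k)}"
  have wE: "w \<in> words n" "w' \<in> words n" "E \<subseteq> {..<n}" "E' \<subseteq> {..<n}" using x y xy by (auto simp: X_def)
  have K: "set (take k l) = set (take k l')" "E - set (take k l) = E' - set (take k l)"
    "\<exists>u. u \<in> lists (avail E (set (take k l))) \<and> state (w @ u) = state w'" if "k \<in> K" for k
  proof -
    have "face (w, E, l) (Suc k) = face (w', E', l') (Suc k)" "(w, E, l) \<in> X" "(w', E', l') \<in> X" "k \<le> n"
      using that x y xy by (auto simp: K_def)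
    then obtain u where "set (take k l) = set (take k l')" "E - set (take k l) = E' - set (take k l)"
      "u \<in> lists (avail E (set (take k l)))" "state (w @ u) = state w'"
      by (rule face_eqD)
    then show "set (take k l) = set (take k l')" "E - set (take k l) = E' - set (take k l)"
      "\<exists>u. u \<in> lists (avail E (set (take k l))) \<and> state (w @ u) = state w'"
      by blast+
  qed
  have fin: "finite K" "K \<subseteq> {..n}" by (auto simp: K_def)
  have "\<exists>u\<in>words n. state (w @ u) = state w' \<and> (K = {} \<or> (\<forall>k\<in>K. u \<in> lists (avail E (set (take k l')))))"
  proof (cases "K = {}")
    case True
    have "state ((w @ rev w) @ w') = state ([] @ w')"
      using state_cancel_word'[of "[]" w] wE by (intro state_append) auto
    then show ?thesis using True wE by (intro bexI[of _ "rev w @ w'"]) auto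
  next
    case False
    let ?m = "Max K"
    have m: "?m \<in> K" using fin False by simp
    then obtain u where u: "u \<in> lists (avail E (set (take ?m l)))" "state (w @ u) = state w'"
      using K(3) by blast
    have "u \<in> lists (avail E (set (take k l')))" if k: "k \<in> K" for k
    proof -
      have "set (take k l') \<subseteq> set (take ?m l)"
        unfolding K(1)[OF m] using fin k by (intro set_take_subset_set_take) simp
      then show ?thesis using u(1) avail_antimono by blast
    qed
    then show ?thesis using u avail_words by blast
  qed
  then obtain u where u: "u \<in> words n" "state (w @ u) = state w'"
    "K = {} \<or> (\<forall>k\<in>K. u \<in> lists (avail E (set (take k l'))))" by blast
  have "(swap_step K)\<^sup>*\<^sup>* l l'"
    using K(1) x y xy by (intro swap_steps_connect) (auto simp: X_def)
  then have step1: "walk K (w, E, l) (w, E, l')"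
    by (rule walk_swap) (use X_length x xy in blast)
  have step2: "walk K (w, E, l') (w @ u, E, l')"
    using u fin wE x y xy by (intro walk_word) (auto simp: X_def)
  have step3: "walk K (w @ u, E, l') (w @ u, sym_diff E (sym_diff E E'), l')"
  proof (rule walk_flips)
    show "i \<in> set (take k l')" if "i \<in> sym_diff E E'" "k \<in> K" for i k
      using that K(1,2)[of k] by blast
  qed (use u wE y xy in \<open>auto simp: X_def\<close>)
  have "sym_diff E (sym_diff E E') = E'" by blast
  then have "walk K x (w @ u, E', l')"
    using walk_trans[OF walk_trans[OF step1 step2] step3] xy by metis
  moreover have "flag (w @ u, E', l') = flag y"
  proof -
    have eq: "face (w @ u, E', l') k = face y k" for k
    proof -
      have "set (take (k - 1) l') \<subseteq> {..<n}" using X_take y xy by blast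
      then have "cell (w @ u) E' (set (take (k - 1) l')) = cell w' E' (set (take (k - 1) l'))"
        using u wE by (intro cell_cong) simp_all
      then show ?thesis using xy by simp
    qed
    show ?thesis unfolding flag_def by (rule image_cong[OF refl]) (rule eq)
  qed
  ultimately show ?thesis unfolding K_def by blast
qed

lemma abstract_polytope_gluing: "abstract_polytope (n + 1) ord"
proof (rule abstract_polytope_ord)
  fix x y assume "x \<in> X" "y \<in> X"
  then have "\<exists>z. flag z = flag y \<and> walk {k. k \<le> n \<and> face x (Suc k) = face y (Suc k)} x z"
    by (rule connected_away_from_common_faces)
  moreover have "(\<lambda>u v. \<exists>k<n + 1. k \<notin> {k. k \<le> n \<and> face x (Suc k) = face y (Suc k)} \<and> v = adj k u) =
      (\<lambda>u v. \<exists>k<n + 1. v = adj k u \<and> face x (Suc k) \<noteq> face y (Suc k))"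
    by (intro ext) auto
  ultimately show "\<exists>z. flag z = flag y \<and>
      (\<lambda>u v. \<exists>k<n + 1. v = adj k u \<and> face x (Suc k) \<noteq> face y (Suc k))\<^sup>*\<^sup>* x z"
    unfolding walk_def by (simp only:)
qed

text \<open>
  The action on flag codes of the pair of a word and a signed permutation.
\<close>

fun move :: "(nat \<times> bool) list \<Rightarrow> (nat \<Rightarrow> nat) \<Rightarrow> nat set \<Rightarrow> (nat \<times> bool) list \<times> nat set \<times> nat list \<Rightarrow>
    (nat \<times> bool) list \<times> nat set \<times> nat list" where
  "move u \<pi> D (w, E, l) = (u @ map (signed_perm \<pi> D) w, sym_diff (\<pi> ` E) D, map \<pi> l)"

context
  fixes u :: "(nat \<times> bool) list" and \<pi> :: "nat \<Rightarrow> nat" and D :: "nat set"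
  assumes u: "u \<in> words n" and \<pi>: "bij_betw \<pi> {..<n} {..<n}" and D: "D \<subseteq> {..<n}"
begin

lemma \<pi>_less: "j < n \<Longrightarrow> \<pi> j < n"
  using \<pi> by (auto simp: bij_betw_def)

lemma inj_\<pi>: "inj_on \<pi> {..<n}"
  using \<pi> by (auto simp: bij_betw_def)

lemma \<pi>_mem_image: "j < n \<Longrightarrow> A \<subseteq> {..<n} \<Longrightarrow> \<pi> j \<in> \<pi> ` A \<longleftrightarrow> j \<in> A"
  using inj_on_image_mem_iff[OF inj_\<pi>] by auto

lemma signed_perm_words: "w \<in> words n \<Longrightarrow> map (signed_perm \<pi> D) w \<in> words n"
  using \<pi>_less by (induction w) (auto simp: letters_def signed_perm_def)

lemma move_in_X: "x \<in> X \<Longrightarrow> move u \<pi> D x \<in> X"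
  using u D \<pi> \<pi>_less signed_perm_words
  by (cases x) (auto simp: X_def bij_betw_def distinct_map dest: subsetD)

lemma avail_signed_perm:
  assumes "E \<subseteq> {..<n}" "A \<subseteq> {..<n}"
  shows "avail (sym_diff (\<pi> ` E) D) (\<pi> ` A) = signed_perm \<pi> D ` avail E A"
proof -
  have "{..<n} - \<pi> ` A = \<pi> ` ({..<n} - A)"
    using \<pi> inj_on_image_set_diff[OF inj_\<pi>, of "{..<n}" A] assms by (auto simp: bij_betw_def)
  moreover have avail: "avail F B = (\<lambda>j. (j, j \<in> F)) ` ({..<n} - B)" for F B
    by (auto simp: avail_def)
  moreover have "(\<pi> j, \<pi> j \<in> sym_diff (\<pi> ` E) D) = signed_perm \<pi> D (j, j \<in> E)" if "j \<in> {..<n} - A" for j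
    using \<pi>_mem_image[of j E] that assms by (auto simp: signed_perm_def)
  ultimately show ?thesis unfolding avail by (simp only: image_image cong: image_cong)
qed

lemma move_adj:
  assumes "x \<in> X" "k < n + 1"
  shows "move u \<pi> D (adj k x) = adj k (move u \<pi> D x)"
proof -
  obtain w E l where x: "x = (w, E, l)" by (metis prod_cases3)
  have l: "length l = n" "l \<noteq> []" using X_length n_ge_2 assms x by fastforce+
  have E: "E \<subseteq> {..<n}" using assms x by (simp add: X_def)
  consider (first) "k = 0" | (last) "k = n" | (mid) "0 < k" "k < n" using assms(2) by linarith
  then show ?thesis
  proof cases
    case first
    have "hd l < n" using X_hd assms x by blast
    then have "\<pi> ` (E - {hd l}) = \<pi> ` E - {\<pi> (hd l)}" "\<pi> ` ({hd l} - E) = {\<pi> (hd l)} - \<pi> ` E"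
      using inj_on_image_set_diff[OF inj_\<pi>, of E "{hd l}"]
        inj_on_image_set_diff[OF inj_\<pi>, of "{hd l}" E] E by auto
    then have "\<pi> ` sym_diff E {hd l} = sym_diff (\<pi> ` E) {\<pi> (hd l)}"
      by (simp only: image_Un)
    then have "sym_diff (\<pi> ` sym_diff E {hd l}) D = sym_diff (sym_diff (\<pi> ` E) D) {\<pi> (hd l)}"
      by auto
    then show ?thesis using x first l by (simp add: hd_map)
  next
    case last
    have "last l < n" using X_last assms x by blast
    then have "signed_perm \<pi> D (last l, last l \<in> E) = (\<pi> (last l), \<pi> (last l) \<in> sym_diff (\<pi> ` E) D)"
      using \<pi>_mem_image[of "last l" E] E by (auto simp: signed_perm_def)
    then show ?thesis using x last l n_ge_2 by (simp add: last_map)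
  next
    case mid
    then show ?thesis using x l map_swap[of k l \<pi>] by simp
  qed
qed

lemma move_automorphism:
  assumes inv: "\<And>v v'. v \<in> words n \<Longrightarrow> v' \<in> words n \<Longrightarrow>
    state (u @ map (signed_perm \<pi> D) v) = state (u @ map (signed_perm \<pi> D) v') \<longleftrightarrow> state v = state v'"
  shows "\<exists>f. poset_automorphism ord f \<and> (\<forall>x\<in>X. f ` flag x = flag (move u \<pi> D x))"
proof -
  let ?\<kappa> = "signed_perm \<pi> D"
  have cell_move: "cell (u @ map ?\<kappa> w) (sym_diff (\<pi> ` E) D) (\<pi> ` A) =
      cell (u @ map ?\<kappa> w') (sym_diff (\<pi> ` E') D) (\<pi> ` A') \<longleftrightarrow> cell w E A = cell w' E' A'"
    if "w \<in> words n" "w' \<in> words n" "E \<subseteq> {..<n}" "E' \<subseteq> {..<n}" "A \<subseteq> {..<n}" "A' \<subseteq> {..<n}" for w w' E E' A A'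
  proof -
    have sub: "\<pi> ` B \<subseteq> {..<n}" if "B \<subseteq> {..<n}" for B using \<pi>_less that by auto
    then have sub': "sym_diff (\<pi> ` B) D \<subseteq> {..<n}" if "B \<subseteq> {..<n}" for B using that D by blast
    have eqA: "\<pi> ` A = \<pi> ` A' \<longleftrightarrow> A = A'" using inj_on_image_eq_iff[OF inj_\<pi>] that by blast
    have diff: "\<pi> ` B - \<pi> ` A = \<pi> ` (B - A)" if "B \<subseteq> {..<n}" for B
      using inj_on_image_set_diff[OF inj_\<pi>, of B A] that \<open>A \<subseteq> {..<n}\<close> by auto
    have "sym_diff (\<pi> ` E) D - \<pi> ` A = sym_diff (\<pi> ` E') D - \<pi> ` A \<longleftrightarrow> \<pi> ` E - \<pi> ` A = \<pi> ` E' - \<pi> ` A"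
      by blast
    also have "\<dots> \<longleftrightarrow> E - A = E' - A"
      using inj_on_image_eq_iff[OF inj_\<pi>, of "E - A" "E' - A"] that diff by auto
    finally have eqE: "sym_diff (\<pi> ` E) D - \<pi> ` A = sym_diff (\<pi> ` E') D - \<pi> ` A \<longleftrightarrow> E - A = E' - A" .
    have "(\<exists>v\<in>lists (avail (sym_diff (\<pi> ` E) D) (\<pi> ` A)). state ((u @ map ?\<kappa> w) @ v) = state (u @ map ?\<kappa> w')) \<longleftrightarrow>
        (\<exists>v\<in>lists (avail E A). state (u @ map ?\<kappa> (w @ v)) = state (u @ map ?\<kappa> w'))"
      using that by (simp add: avail_signed_perm lists_image)
    also have "\<dots> \<longleftrightarrow> (\<exists>v\<in>lists (avail E A). state (w @ v) = state w')"
      using that avail_words by (intro bex_cong refl inv) simp_all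
    finally have eqw: "(\<exists>v\<in>lists (avail (sym_diff (\<pi> ` E) D) (\<pi> ` A)). state ((u @ map ?\<kappa> w) @ v) = state (u @ map ?\<kappa> w')) \<longleftrightarrow>
      (\<exists>v\<in>lists (avail E A). state (w @ v) = state w')" .
    have words: "u @ map ?\<kappa> w \<in> words n" "u @ map ?\<kappa> w' \<in> words n"
      using u signed_perm_words that by simp_all
    show ?thesis
      unfolding cell_eq_iff[OF words sub'[OF that(3)] sub'[OF that(4)] sub[OF that(5)] sub[OF that(6)], folded avail_def]
        cell_eq_iff[OF that, folded avail_def] eqA eqE eqw ..
  qed
  have cong: "face (move u \<pi> D x) i = face (move u \<pi> D y) i \<longleftrightarrow> face x i = face y i" if xy: "x \<in> X" "y \<in> X" for x y i
  proof -
    obtain w E l w' E' l' where x: "x = (w, E, l)" "y = (w', E', l')" by (metis prod_cases3)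
    have "set (take (i - 1) l) \<subseteq> {..<n}" "set (take (i - 1) l') \<subseteq> {..<n}" using X_take xy x by blast+
    then show ?thesis
      using cell_move[of w w' E E' "set (take (i - 1) l)" "set (take (i - 1) l')"] xy x
      by (simp add: X_def take_map)
  qed
  obtain f where "poset_automorphism ord f" "\<And>x. x \<in> X \<Longrightarrow> f ` flag x = flag (move u \<pi> D x)"
    using automorphism_of_flag_map[of "move u \<pi> D"] move_in_X cong by blast
  then show ?thesis by blast
qed

end

text \<open>
  The invariant that separates the flag orbits.
\<close>

definition parity :: "(nat \<times> bool) list \<times> nat set \<times> nat list \<Rightarrow> bool" where
  "parity = (\<lambda>(w, E, l). even (length w + card E))"

text \<open>
  Take the permutation from the orders of the two flags, the sign changes from the vertices, and
  cancel the image of \<open>w\<close> after \<open>w'\<close>. The last property concerns words read from the flag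
  of \<open>w\<close>: going back along \<open>w\<close> first makes them words read from the empty word.
\<close>

lemma move_between:
  assumes "(w, E, l) \<in> X" "(w', E', l') \<in> X"
  obtains u \<pi> D where "u \<in> words n" "bij_betw \<pi> {..<n} {..<n}" "D \<subseteq> {..<n}"
    "flag (move u \<pi> D (w, E, l)) = flag (w', E', l')"
    "even (length u + card D) \<longleftrightarrow> (parity (w, E, l) \<longleftrightarrow> parity (w', E', l'))"
    "\<forall>v\<in>words n. state (u @ map (signed_perm \<pi> D) (w @ rev w @ v)) = state (u @ map (signed_perm \<pi> D) v)"
proof -
  have len: "length l = n" "length l' = n" using X_length assms by auto
  have X: "w \<in> words n" "w' \<in> words n" "E \<subseteq> {..<n}" "E' \<subseteq> {..<n}" "distinct l" "distinct l'"
    "set l = {..<n}" "set l' = {..<n}"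
    using assms by (auto simp: X_def)
  define \<pi> where "\<pi> j = l' ! (THE i. i < n \<and> l ! i = j)" for j
  have pi_l: "\<pi> (l ! i) = l' ! i" if "i < n" for i
  proof -
    have "(THE i'. i' < n \<and> l ! i' = l ! i) = i"
      using that X len by (intro the_equality) (auto simp: nth_eq_iff_index_eq)
    then show ?thesis by (simp add: \<pi>_def)
  qed
  have map_pi: "map \<pi> l = l'" using pi_l len by (intro nth_equalityI) auto
  then have "distinct (map \<pi> l)" using X by simp
  then have bij: "bij_betw \<pi> {..<n} {..<n}"
  proof -
    have "inj_on \<pi> (set l)" using \<open>distinct (map \<pi> l)\<close> by (simp add: distinct_map)
    moreover have "\<pi> ` set l = set l'" using map_pi set_map[of \<pi> l] by simp
    ultimately show ?thesis using X by (simp add: bij_betw_def)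
  qed
  define D where "D = sym_diff (\<pi> ` E) E'"
  have piE: "\<pi> ` E \<subseteq> {..<n}" using bij X(3) unfolding bij_betw_def by blast
  then have D: "D \<subseteq> {..<n}" using X by (auto simp: D_def)
  let ?\<kappa> = "signed_perm \<pi> D"
  define u where "u = w' @ rev (map ?\<kappa> w)"
  have words: "map ?\<kappa> v \<in> words n" if "v \<in> words n" for v
    using signed_perm_words[OF _ bij D that] X by blast
  then have u: "u \<in> words n" using X by (simp add: u_def)
  have "state (u @ map ?\<kappa> w) = state w'"
    using state_cancel_word X words by (simp add: u_def)
  moreover have "sym_diff (\<pi> ` E) D = E'" by (auto simp: D_def)
  ultimately have "face (move u \<pi> D (w, E, l)) k = face (w', E', l') k" for k
  proof -
    have "set (take (k - 1) l') \<subseteq> {..<n}" using X_take assms by blast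
    then have "cell (u @ map ?\<kappa> w) E' (set (take (k - 1) l')) = cell w' E' (set (take (k - 1) l'))"
      using \<open>state (u @ map ?\<kappa> w) = state w'\<close> u X words by (intro cell_cong) simp_all
    then show ?thesis using map_pi \<open>sym_diff (\<pi> ` E) D = E'\<close> by simp
  qed
  then have flag: "flag (move u \<pi> D (w, E, l)) = flag (w', E', l')"
    unfolding flag_def by (intro image_cong[OF refl])
  have "even (card D) \<longleftrightarrow> even (card E + card E')"
  proof -
    have "finite (\<pi> ` E)" "finite E'"
      using finite_subset[OF piE] finite_subset[OF X(4)] by simp_all
    moreover have "card (\<pi> ` E) = card E"
      using bij X by (intro card_image) (auto simp: bij_betw_def intro: inj_on_subset)
    ultimately show ?thesis unfolding D_def using even_card_sym_diff[of "\<pi> ` E" E'] by simp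
  qed
  then have par: "even (length u + card D) \<longleftrightarrow> (parity (w, E, l) \<longleftrightarrow> parity (w', E', l'))"
    by (auto simp: u_def parity_def)
  have cancel: "\<forall>v\<in>words n. state (u @ map ?\<kappa> (w @ rev w @ v)) = state (u @ map ?\<kappa> v)"
  proof
    fix v assume v: "v \<in> words n"
    have "state ((u @ map ?\<kappa> w @ rev (map ?\<kappa> w)) @ map ?\<kappa> v) = state (u @ map ?\<kappa> v)"
      using state_cancel_word' u words X v by (intro state_append) auto
    then show "state (u @ map ?\<kappa> (w @ rev w @ v)) = state (u @ map ?\<kappa> v)" by (simp add: rev_map)
  qed
  show ?thesis using that[OF u bij D flag par cancel] .
qed

lemma flag_state_cong:
  assumes "(w, E, l) \<in> X" "w' \<in> words n" "state w = state w'"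
  shows "flag (w, E, l) = flag (w', E, l)"
  unfolding flag_def
proof (rule image_cong[OF refl])
  fix k
  have "set (take (k - 1) l) \<subseteq> {..<n}" using X_take assms by blast
  then have "cell w E (set (take (k - 1) l)) = cell w' E (set (take (k - 1) l))"
    using assms by (intro cell_cong) (auto simp: X_def)
  then show "face (w, E, l) k = face (w', E, l) k" by simp
qed

lemma flag_eqD:
  assumes "flag (w, E, l) = flag (w', E', l')" "(w, E, l) \<in> X" "(w', E', l') \<in> X"
  shows "E = E'" "state w = state w'"
proof -
  have face: "face (w, E, l) (Suc k) = face (w', E', l') (Suc k)" if "k \<le> n" for k
    using flag_eq_iff[OF assms(2,3)] assms(1) that by (simp del: face.simps)
  have "E - set (take 0 l) = E' - set (take 0 l)"
    by (rule face_eqD[OF face[of 0] assms(2,3)]) auto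
  then show "E = E'" by simp
  obtain u where "set (take n l) = set (take n l')" "E - set (take n l) = E' - set (take n l)"
    "u \<in> lists (avail E (set (take n l)))" "state (w @ u) = state w'"
    by (rule face_eqD[OF face[of n] assms(2,3)]) auto
  then show "state w = state w'" unfolding X_take_n[OF assms(2)] avail_UNIV by simp
qed

text \<open>
  An automorphism that changes the parity agrees on one flag, hence on all flags, with the action of an
  odd pair \<open>(u, \<kappa>)\<close>. This action would then respect equality of states, which is excluded.
\<close>

theorem symmetry_type_graph_gluing:
  assumes even_inv: "\<And>u \<pi> D v v'. u \<in> words n \<Longrightarrow> bij_betw \<pi> {..<n} {..<n} \<Longrightarrow> D \<subseteq> {..<n} \<Longrightarrow>
      even (length u + card D) \<Longrightarrow> v \<in> words n \<Longrightarrow> v' \<in> words n \<Longrightarrow>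
      state (u @ map (signed_perm \<pi> D) v) = state (u @ map (signed_perm \<pi> D) v') \<longleftrightarrow> state v = state v'"
    and odd_not_inv: "\<And>u \<pi> D. u \<in> words n \<Longrightarrow> bij_betw \<pi> {..<n} {..<n} \<Longrightarrow> D \<subseteq> {..<n} \<Longrightarrow>
      odd (length u + card D) \<Longrightarrow> \<exists>v\<in>words n. \<exists>v'\<in>words n. state v = state v' \<and>
      state (u @ map (signed_perm \<pi> D) v) \<noteq> state (u @ map (signed_perm \<pi> D) v')"
  shows "isomorphic (symmetry_type_graph (n + 1) ord) (two_vertex (n + 1) {1..n - 1})"
proof (rule symmetry_type_graph_two_vertex)
  have "0 \<in> {..<n + 1}" "0 \<notin> {1..n - 1}" "{1..n - 1} \<subseteq> {..<n + 1}"
    by (auto simp only: atLeastAtMost_iff lessThan_iff subset_iff)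
  then show "{1..n - 1} \<subset> {..<n + 1}" by (metis psubsetI)
  show "parity x = parity y" if xy: "x \<in> X" "y \<in> X" "flag x = flag y" for x y
  proof -
    obtain w E l w' E' l' where x: "x = (w, E, l)" "y = (w', E', l')" by (metis prod_cases3)
    then have "E = E'" "state w = state w'" using flag_eqD[of w E l w' E' l'] xy by simp_all
    moreover have "w \<in> words n" "w' \<in> words n" using xy x by (simp_all add: X_def)
    ultimately show ?thesis using state_parity[of w w'] x by (simp add: parity_def)
  qed
  show "parity (adj k x) = (if k \<in> {1..n - 1} then parity x else \<not> parity x)"
    if "x \<in> X" "k < n + 1" for x k
  proof -
    obtain w E l where x: "x = (w, E, l)" by (metis prod_cases3)
    have "finite E" using that x finite_subset by (auto simp: X_def)
    then show ?thesis
      using x that n_ge_2 even_card_sym_diff[of E "{hd l}"] by (auto simp: parity_def)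
  qed
  show "\<exists>f. poset_automorphism ord f \<and> f ` flag x = flag y"
    if xy: "x \<in> X" "y \<in> X" "parity x = parity y" for x y
  proof -
    obtain w E l w' E' l' where x: "x = (w, E, l)" "y = (w', E', l')" by (metis prod_cases3)
    obtain u \<pi> D where m: "u \<in> words n" "bij_betw \<pi> {..<n} {..<n}" "D \<subseteq> {..<n}"
      "flag (move u \<pi> D (w, E, l)) = flag (w', E', l')"
      "even (length u + card D) \<longleftrightarrow> (parity (w, E, l) \<longleftrightarrow> parity (w', E', l'))"
      "\<forall>v\<in>words n. state (u @ map (signed_perm \<pi> D) (w @ rev w @ v)) = state (u @ map (signed_perm \<pi> D) v)"
      by (rule move_between[OF xy(1,2)[unfolded x]])
    have even: "even (length u + card D)" using m(5) xy(3) x by simp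
    obtain f where "poset_automorphism ord f" "\<forall>x\<in>X. f ` flag x = flag (move u \<pi> D x)"
      using move_automorphism[OF m(1-3) even_inv[OF m(1-3) even]] by blast
    then show ?thesis using xy(1) m(4) unfolding x by (intro exI[of _ f]) auto
  qed
  show "parity x = parity y"
    if f: "poset_automorphism ord f" and xy: "x \<in> X" "y \<in> X" "f ` flag x = flag y" for f x y
  proof (rule ccontr)
    assume neq: "parity x \<noteq> parity y"
    obtain w E l w' E' l' where x: "x = (w, E, l)" "y = (w', E', l')" by (metis prod_cases3)
    obtain u \<pi> D where m: "u \<in> words n" "bij_betw \<pi> {..<n} {..<n}" "D \<subseteq> {..<n}"
      "flag (move u \<pi> D (w, E, l)) = flag (w', E', l')"
      "even (length u + card D) \<longleftrightarrow> (parity (w, E, l) \<longleftrightarrow> parity (w', E', l'))"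
      and cancel: "\<forall>v\<in>words n.
        state (u @ map (signed_perm \<pi> D) (w @ rev w @ v)) = state (u @ map (signed_perm \<pi> D) v)"
      by (rule move_between[OF xy(1,2)[unfolded x]])
    have odd: "odd (length u + card D)" using m(5) neq x by simp
    obtain v v' where v: "v \<in> words n" "v' \<in> words n" "state v = state v'"
      "state (u @ map (signed_perm \<pi> D) v) \<noteq> state (u @ map (signed_perm \<pi> D) v')"
      using odd_not_inv[OF m(1-3) odd] by blast
    have w: "w \<in> words n" using xy x by (simp add: X_def)
    let ?z = "\<lambda>v. (w @ rev w @ v, E, l)"
    have z: "?z v \<in> X" if "v \<in> words n" for v using xy x that by (simp add: X_def)
    have f_z: "f ` flag (?z v) = flag (move u \<pi> D (?z v))" if "v \<in> words n" for v
    proof (rule automorphism_eq_flag_map[OF f, of x])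
      show "f ` flag x = flag (move u \<pi> D x)" using xy x m by simp
      show "move u \<pi> D y \<in> X" if "y \<in> X" for y using move_in_X[OF m(1-3) that] .
      show "flag (move u \<pi> D (adj k y)) = flag (adj k (move u \<pi> D y))" if "y \<in> X" "k < n + 1" for y k
        using move_adj[OF m(1-3) that] by simp
      have "walk {} x (?z v)"
        using walk_word[of w E l "rev w @ v" "{}"] xy x w that by simp
      then show "(\<lambda>u v. \<exists>k<n + 1. v = adj k u)\<^sup>*\<^sup>* x (?z v)" by (simp add: walk_def)
    qed (use xy in auto)
    have "state (w @ rev w @ v) = state (w @ rev w @ v')"
    proof -
      have "state ((w @ rev w) @ v) = state ([] @ v)" if "v \<in> words n" for v
        using state_cancel_word'[of "[]" w] w that by (intro state_append) auto
      then show ?thesis using v by simp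
    qed
    then have "flag (?z v) = flag (?z v')"
      using flag_state_cong z v w by simp
    then have "flag (move u \<pi> D (?z v)) = flag (move u \<pi> D (?z v'))"
      using f_z v by metis
    then have "state (u @ map (signed_perm \<pi> D) (w @ rev w @ v)) = state (u @ map (signed_perm \<pi> D) (w @ rev w @ v'))"
      using flag_eqD(2) move_in_X[OF m(1-3) z] v unfolding move.simps by blast
    then show False using cancel v by simp
  qed
qed

end

section \<open>A chiral family of states\<close>

text \<open>
  The sets \<open>H\<close> index the ways to choose one facet from each pair of opposite facets.
\<close>

definition hits :: "nat \<times> bool \<Rightarrow> nat set \<Rightarrow> bool" where
  "hits c H \<longleftrightarrow> (fst c \<in> H) = snd c"

text \<open>
  Both functions look only at the letters of the word that hit \<open>H\<close>: the sign tells whether their number is even,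
  and the count of \<open>j\<close> adds up \<open>(-1)\<^sup>i\<close> over the positions \<open>i\<close> at which their coordinate is \<open>j\<close>. Thus \<open>letter_count\<close> is a cocycle
  for \<open>word_sign\<close>, see \<open>letter_count_append\<close>.
\<close>

fun word_sign :: "nat set \<Rightarrow> (nat \<times> bool) list \<Rightarrow> 'r :: comm_ring_1" where
  "word_sign H [] = 1"
| "word_sign H (c # w) = (if hits c H then - word_sign H w else word_sign H w)"

fun letter_count :: "nat set \<Rightarrow> nat \<Rightarrow> (nat \<times> bool) list \<Rightarrow> 'r :: comm_ring_1" where
  "letter_count H j [] = 0"
| "letter_count H j (c # w) = (if hits c H then of_bool (fst c = j) - letter_count H j w else letter_count H j w)"

lemma word_sign_append: "word_sign H (v @ w) = word_sign H v * word_sign H w"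
  by (induction v) auto

lemma letter_count_append: "letter_count H j (v @ w) = letter_count H j v + word_sign H v * letter_count H j w"
  by (induction v) (auto simp: algebra_simps)

lemma word_sign_square [simp]: "word_sign H w * word_sign H w = 1"
  by (induction w) auto

lemma word_sign_cancel: "word_sign H w * a = word_sign H w * b \<longleftrightarrow> a = b"
proof
  assume "word_sign H w * a = word_sign H w * b"
  then have "(word_sign H w * word_sign H w) * a = (word_sign H w * word_sign H w) * b" by (simp only: mult.assoc)
  then show "a = b" by simp
qed simp

lemma hits_complement: "c \<in> letters n \<Longrightarrow> hits c ({..<n} - H) \<longleftrightarrow> \<not> hits c H"
  by (auto simp: hits_def letters_def)

lemma word_sign_complement:
  "w \<in> words n \<Longrightarrow> word_sign ({..<n} - H) w = (-1) ^ length w * word_sign H w"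
  by (induction w) (auto simp: hits_complement)

text \<open>
  The set hit by a letter exactly if its image under the signed permutation hits \<open>H\<close>.
\<close>

definition pull :: "nat \<Rightarrow> (nat \<Rightarrow> nat) \<Rightarrow> nat set \<Rightarrow> nat set \<Rightarrow> nat set" where
  "pull n \<pi> D H = {j. j < n \<and> (\<pi> j \<in> H) \<noteq> (\<pi> j \<in> D)}"

lemma hits_signed_perm: "c \<in> letters n \<Longrightarrow> hits (signed_perm \<pi> D c) H \<longleftrightarrow> hits c (pull n \<pi> D H)"
  by (auto simp: hits_def letters_def signed_perm_def pull_def)

lemma word_sign_signed_perm: "w \<in> words n \<Longrightarrow> word_sign H (map (signed_perm \<pi> D) w) = word_sign (pull n \<pi> D H) w"
  by (induction w) (auto simp: hits_signed_perm)

lemma letter_count_signed_perm: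
  assumes "inj_on \<pi> {..<n}" "j < n" "w \<in> words n"
  shows "letter_count H (\<pi> j) (map (signed_perm \<pi> D) w) = letter_count (pull n \<pi> D H) j w"
  using assms(3)
proof (induction w)
  case (Cons c w)
  then have "\<pi> (fst c) = \<pi> j \<longleftrightarrow> fst c = j"
    using inj_on_eq_iff[OF assms(1)] assms(2) by (auto simp: letters_def)
  then show ?case
    using Cons hits_signed_perm[of c n \<pi> D H] by (simp add: signed_perm_def)
qed simp

lemma pull_complement:
  "(\<And>j. j < n \<Longrightarrow> \<pi> j < n) \<Longrightarrow> pull n \<pi> D ({..<n} - H) = {..<n} - pull n \<pi> D H"
  by (auto simp: pull_def)

context
  fixes n :: nat and \<pi> :: "nat \<Rightarrow> nat" and D :: "nat set"
  assumes \<pi>: "bij_betw \<pi> {..<n} {..<n}" and D: "D \<subseteq> {..<n}"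
begin

lemma image_pull: "H \<subseteq> {..<n} \<Longrightarrow> \<pi> ` pull n \<pi> D H = sym_diff H D"
proof -
  assume H: "H \<subseteq> {..<n}"
  have im: "\<pi> ` {..<n} = {..<n}" using \<pi> by (simp add: bij_betw_def)
  have "pull n \<pi> D H = {j \<in> {..<n}. \<pi> j \<in> sym_diff H D}" by (auto simp: pull_def)
  then have "\<pi> ` pull n \<pi> D H = \<pi> ` {..<n} \<inter> sym_diff H D" by blast
  then show ?thesis unfolding im using H D by blast
qed

lemma even_card_pull: "H \<subseteq> {..<n} \<Longrightarrow> even (card (pull n \<pi> D H)) \<longleftrightarrow> even (card H + card D)"
proof -
  assume H: "H \<subseteq> {..<n}"
  have "inj_on \<pi> (pull n \<pi> D H)"
    using \<pi> by (auto simp: bij_betw_def pull_def intro: inj_on_subset)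
  then have "card (pull n \<pi> D H) = card (sym_diff H D)"
    using image_pull[OF H] card_image by metis
  then show ?thesis
    using even_card_sym_diff[of H D] finite_subset[OF H] finite_subset[OF D] by simp
qed

lemma pull_surj:
  assumes "H \<subseteq> {..<n}"
  obtains G where "G \<subseteq> {..<n}" "pull n \<pi> D G = H"
proof
  have inj: "inj_on \<pi> {..<n}" and im: "\<pi> ` {..<n} = {..<n}" using \<pi> by (auto simp: bij_betw_def)
  show "sym_diff (\<pi> ` H) D \<subseteq> {..<n}" using im assms D by blast
  have "\<pi> j \<in> \<pi> ` H \<longleftrightarrow> j \<in> H" if "j < n" for j
    using inj_on_image_mem_iff[OF inj, of j H] that assms by simp
  then show "pull n \<pi> D (sym_diff (\<pi> ` H) D) = H" using assms by (auto simp: pull_def)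
qed

end

text \<open>
  For a word \<open>v\<close> of sign 1, writing \<open>v c\<close> twice doubles the counts of \<open>v\<close> for the sets that \<open>c\<close> does not hit and cancels them
  for the others. Doing so with the facets opposite to those chosen by \<open>G\<close> leaves only \<open>G\<close>.
\<close>

fun localize :: "nat set \<Rightarrow> nat list \<Rightarrow> (nat \<times> bool) list \<Rightarrow> (nat \<times> bool) list" where
  "localize G [] v = v"
| "localize G (k # ks) v = localize G ks v @ [(k, k \<notin> G)] @ localize G ks v @ [(k, k \<notin> G)]"

lemma localize_words: "set ks \<subseteq> {..<n} \<Longrightarrow> v \<in> words n \<Longrightarrow> localize G ks v \<in> words n"
  by (induction ks) (auto simp: letters_def)

lemma word_sign_localize: "word_sign H v = (1 :: 'r :: comm_ring_1) \<Longrightarrow> word_sign H (localize G ks v) = (1 :: 'r)"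
  by (induction ks) (auto simp: word_sign_append)

lemma letter_count_localize:
  assumes "word_sign H v = (1 :: 'r :: comm_ring_1)"
  shows "letter_count H j (localize G ks v) =
    (if \<forall>k\<in>set ks. k \<in> H \<longleftrightarrow> k \<in> G then 2 ^ length ks * letter_count H j v else (0 :: 'r))"
proof (induction ks)
  case (Cons k ks)
  have s: "word_sign H (localize G ks v) = (1 :: 'r)" using word_sign_localize assms .
  show ?case
  proof (cases "k \<in> H \<longleftrightarrow> k \<in> G")
    case True
    then have "\<not> hits (k, k \<notin> G) H" by (auto simp: hits_def)
    then show ?thesis using True Cons s by (simp add: letter_count_append)
  next
    case False
    then have "hits (k, k \<notin> G) H" by (auto simp: hits_def)
    then show ?thesis using False s by (auto simp: letter_count_append algebra_simps)
  qed
qed simp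

text \<open>
  The square of the product of two letters has sign 1 for every \<open>H\<close>, and its count of the
  coordinate 0 is 2 for those \<open>H\<close> that both letters hit.
\<close>

definition spike :: "nat \<Rightarrow> nat set \<Rightarrow> (nat \<times> bool) list" where
  "spike n G = localize G [0..<n] [(0, 0 \<in> G), (1, 1 \<in> G), (0, 0 \<in> G), (1, 1 \<in> G)]"

lemma spike_words: "2 \<le> n \<Longrightarrow> spike n G \<in> words n"
  unfolding spike_def by (rule localize_words) (auto simp: letters_def)

lemma word_sign_spike: "word_sign H (spike n G) = 1"
  unfolding spike_def by (rule word_sign_localize) simp

lemma letter_count_spike:
  assumes "H \<subseteq> {..<n}" "G \<subseteq> {..<n}" "2 \<le> n"
  shows "letter_count H j (spike n G) =
    (if H = G then 2 ^ n * (2 * of_bool (j = 0) - 2 * of_bool (j = 1)) else (0 :: 'r :: comm_ring_1))"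
proof -
  let ?v = "[(0, 0 \<in> G), (1, 1 \<in> G), (0, 0 \<in> G), (1, 1 \<in> G)]"
  have "(\<forall>k\<in>set [0..<n]. k \<in> H \<longleftrightarrow> k \<in> G) \<longleftrightarrow> H = G" using assms by auto
  moreover have "letter_count G j ?v = 2 * of_bool (j = 0) - 2 * (of_bool (j = 1) :: 'r)"
    by (auto simp: hits_def)
  ultimately show ?thesis
    unfolding spike_def by (subst letter_count_localize) auto
qed

context
  fixes n :: nat and \<mu> half :: "'r :: {comm_ring_1, finite}" and p :: nat
  assumes n_ge_2: "2 \<le> n" and \<mu>: "\<mu> * \<mu> = (-1) ^ n" and half: "2 * half = 1"
    and p: "of_nat p = \<mu> * (-1) ^ n"
begin

text \<open>
  The map \<open>f - \<mu> J f\<close> applied to the counts \<open>f\<close> of a word, where \<open>J\<close> exchanges \<open>H\<close> and its complement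
  up to the sign \<open>(-1)\<^bsup>card H\<^esup>\<close>.
\<close>

definition twist :: "nat set \<Rightarrow> nat \<Rightarrow> (nat \<times> bool) list \<Rightarrow> 'r" where
  "twist H j w = letter_count H j w - \<mu> * (-1) ^ card H * letter_count ({..<n} - H) j w"

text \<open>
  The value outside the relevant range is fixed in order to have finitely many states.
\<close>

definition state :: "(nat \<times> bool) list \<Rightarrow> nat set \<times> nat \<Rightarrow> 'r \<times> 'r" where
  "state w = (\<lambda>(H, j). if H \<subseteq> {..<n} \<and> j < n then (word_sign H w, twist H j w) else (0, 0))"

lemma state_eq_iff:
  "state w = state w' \<longleftrightarrow> (\<forall>H\<subseteq>{..<n}. \<forall>j<n. word_sign H w = (word_sign H w' :: 'r) \<and> twist H j w = twist H j w')"
  unfolding state_def fun_eq_iff by (auto split: prod.splits)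

lemma state_eqD:
  assumes "state w = state w'" "H \<subseteq> {..<n}"
  shows "word_sign H w = (word_sign H w' :: 'r)" "j < n \<Longrightarrow> twist H j w = twist H j w'"
  using assms n_ge_2 unfolding state_eq_iff by (metis zero_less_numeral order_less_le_trans)+

lemma power_two_neq_zero: "(2 :: 'r) ^ k \<noteq> 0"
proof
  assume "(2 :: 'r) ^ k = 0"
  then have "(2 * half) ^ k = 0" by (simp add: power_mult_distrib)
  then show False using half by simp
qed

lemma minus_one_power_eq_iff: "(-1 :: 'r) ^ a = (-1) ^ b \<longleftrightarrow> (even a \<longleftrightarrow> even b)"
proof -
  have "(1 :: 'r) \<noteq> -1"
  proof
    assume "(1 :: 'r) = -1"
    then have "(2 :: 'r) ^ 1 = 0" by (metis add.right_inverse one_add_one power_one_right)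
    then show False using power_two_neq_zero by blast
  qed
  then show ?thesis by (cases "even a"; cases "even b") auto
qed

lemma finite_range_state: "finite (range state)"
proof (rule finite_subset)
  let ?F = "{f. \<forall>a. (a \<in> Pow {..<n} \<times> {..<n} \<longrightarrow> f a \<in> (UNIV :: ('r \<times> 'r) set)) \<and>
    (a \<notin> Pow {..<n} \<times> {..<n} \<longrightarrow> f a = (0, 0))}"
  show "range state \<subseteq> ?F" by (auto simp: state_def split: if_splits)
  show "finite ?F" by (rule finite_set_of_finite_funs) auto
qed

lemma state_append:
  assumes "state w = state w'"
  shows "state (w @ u) = state (w' @ u)"
  unfolding state_eq_iff
proof (intro allI impI conjI)
  fix H j assume H: "H \<subseteq> {..<n}" "j < n"
  note eq = state_eqD(1)[OF assms H(1)] state_eqD(2)[OF assms H] state_eqD(1)[OF assms, of "{..<n} - H"]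
  show "word_sign H (w @ u) = (word_sign H (w' @ u) :: 'r)" using eq by (simp add: word_sign_append)
  have "twist H j (v @ u) = twist H j v + (word_sign H v * letter_count H j u - \<mu> * (-1) ^ card H * (word_sign ({..<n} - H) v * letter_count ({..<n} - H) j u))" for v
    by (simp add: twist_def letter_count_append algebra_simps)
  then show "twist H j (w @ u) = twist H j (w' @ u)" using eq by simp
qed

lemma state_cancel: "state (w @ [c, c]) = state w"
  by (auto simp: state_eq_iff word_sign_append twist_def letter_count_append)

lemma state_parity:
  assumes "w \<in> words n" "w' \<in> words n" "state w = state w'"
  shows "even (length w) \<longleftrightarrow> even (length w')"
proof -
  have "(-1) ^ length w * word_sign {} w = (-1) ^ length w' * (word_sign {} w' :: 'r)"
    using state_eqD(1)[OF assms(3), of "{..<n}"]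
      word_sign_complement[OF assms(1), of "{}", where 'a = 'r] word_sign_complement[OF assms(2), of "{}", where 'a = 'r]
    by simp
  then have "(word_sign {} w * (-1) ^ length w :: 'r) = word_sign {} w * (-1) ^ length w'"
    using state_eqD(1)[OF assms(3), of "{}"] by (simp add: mult.commute)
  then show ?thesis unfolding word_sign_cancel minus_one_power_eq_iff .
qed

text \<open>
  The sign that \<open>u\<close> and the sign changes \<open>D\<close> put in front of the second summand is trivial in the even
  case, where a twist is obtained again.
\<close>

lemma twist_move:
  assumes "u \<in> words n" "bij_betw \<pi> {..<n} {..<n}" "D \<subseteq> {..<n}" "v \<in> words n" "H \<subseteq> {..<n}" "j < n"
  defines "K \<equiv> pull n \<pi> D H"
  shows "twist H (\<pi> j) (u @ map (signed_perm \<pi> D) v) = twist H (\<pi> j) u +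
    word_sign H u * (letter_count K j v - (-1) ^ (length u + card D) * (\<mu> * (-1) ^ card K * letter_count ({..<n} - K) j v))"
proof -
  have inj: "inj_on \<pi> {..<n}" and less: "\<And>j. j < n \<Longrightarrow> \<pi> j < n"
    using assms(2) by (auto simp: bij_betw_def)
  have compl: "pull n \<pi> D ({..<n} - H) = {..<n} - K"
    unfolding K_def using less by (rule pull_complement)
  have "(-1 :: 'r) ^ card H = (-1) ^ (card D + card K)"
    using even_card_pull[OF assms(2,3,5)] unfolding minus_one_power_eq_iff K_def by auto
  then have sign: "(-1 :: 'r) ^ card H * (-1) ^ length u = (-1) ^ (length u + card D) * (-1) ^ card K"
    by (simp add: power_add algebra_simps)
  have letter_count: "letter_count H (\<pi> j) (map (signed_perm \<pi> D) v) = (letter_count K j v :: 'r)"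
    "letter_count ({..<n} - H) (\<pi> j) (map (signed_perm \<pi> D) v) = (letter_count ({..<n} - K) j v :: 'r)"
    by (simp_all add: letter_count_signed_perm[OF inj assms(6,4)] compl flip: K_def)
  have "twist H (\<pi> j) (u @ map (signed_perm \<pi> D) v) = twist H (\<pi> j) u + word_sign H u * letter_count K j v -
      \<mu> * ((-1) ^ card H * (-1) ^ length u) * word_sign H u * letter_count ({..<n} - K) j v"
    unfolding twist_def letter_count_append letter_count word_sign_complement[OF assms(1)] by (simp add: algebra_simps)
  then show ?thesis unfolding sign by (simp add: algebra_simps)
qed

lemma word_sign_move:
  assumes "v \<in> words n"
  shows "word_sign H (u @ map (signed_perm \<pi> D) v) = word_sign H u * word_sign (pull n \<pi> D H) v"
  by (simp add: word_sign_append word_sign_signed_perm[OF assms])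

lemma state_move_even:
  assumes "u \<in> words n" "bij_betw \<pi> {..<n} {..<n}" "D \<subseteq> {..<n}" "even (length u + card D)"
    "v \<in> words n" "v' \<in> words n"
  shows "state (u @ map (signed_perm \<pi> D) v) = state (u @ map (signed_perm \<pi> D) v') \<longleftrightarrow> state v = state v'"
proof -
  let ?m = "\<lambda>v. u @ map (signed_perm \<pi> D) v"
  have twist: "twist H (\<pi> j) (?m v) = twist H (\<pi> j) u + word_sign H u * twist (pull n \<pi> D H) j v"
    if "v \<in> words n" "H \<subseteq> {..<n}" "j < n" for v H j
    using twist_move[OF assms(1-3) that] assms(4) by (simp add: twist_def)
  have pull: "pull n \<pi> D H \<subseteq> {..<n}" for H by (auto simp: pull_def)
  have less: "\<pi> j < n" if "j < n" for j using assms(2) that by (auto simp: bij_betw_def)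
  show ?thesis
  proof
    assume eq: "state v = state v'"
    show "state (?m v) = state (?m v')"
      unfolding state_eq_iff
    proof (intro allI impI conjI)
      fix H i assume H: "H \<subseteq> {..<n}" "i < n"
      then obtain j where j: "j < n" "i = \<pi> j" using assms(2) by (auto simp: bij_betw_def set_eq_iff image_iff)
      show "word_sign H (?m v) = (word_sign H (?m v') :: 'r)"
        using state_eqD(1)[OF eq pull] assms by (simp add: word_sign_move)
      show "twist H i (?m v) = twist H i (?m v')"
        using state_eqD(2)[OF eq pull j(1)] twist[of v H j] twist[of v' H j] assms H j by simp
    qed
  next
    assume eq: "state (?m v) = state (?m v')"
    show "state v = state v'"
      unfolding state_eq_iff
    proof (intro allI impI conjI)
      fix H j assume H: "H \<subseteq> {..<n}" "j < n"
      obtain G where G: "G \<subseteq> {..<n}" "pull n \<pi> D G = H" using pull_surj[OF assms(2,3) H(1)] .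
      have "word_sign G u * word_sign H v = word_sign G u * (word_sign H v' :: 'r)"
        using state_eqD(1)[OF eq G(1)] G assms by (simp add: word_sign_move)
      then show "word_sign H v = (word_sign H v' :: 'r)" unfolding word_sign_cancel .
      have "word_sign G u * twist H j v = word_sign G u * twist H j v'"
        using state_eqD(2)[OF eq G(1) less[OF H(2)]] twist[of v G j] twist[of v' G j] assms G H by simp
      then show "twist H j v = twist H j v'" unfolding word_sign_cancel .
    qed
  qed
qed

text \<open>
  Its counts are \<open>f\<close> at the empty set and \<open>\<mu> (-1)\<^sup>n f\<close> at the full set. As \<open>\<mu>\<^sup>2 = (-1)\<^sup>n\<close>, its twist
  vanishes, but it does not vanish if the sign in the twist is reversed, which is what odd pairs do.
\<close>

definition chiral_word :: "(nat \<times> bool) list" where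
  "chiral_word = spike n {} @ concat (replicate p (spike n {..<n}))"

lemma chiral_word_words: "chiral_word \<in> words n"
proof -
  have "concat (replicate q (spike n {..<n})) \<in> words n" for q
    using spike_words n_ge_2 by (induction q) auto
  then show ?thesis using spike_words n_ge_2 by (simp add: chiral_word_def)
qed

lemma word_sign_chiral_word: "word_sign H chiral_word = 1"
proof -
  have "word_sign H (concat (replicate q (spike n {..<n}))) = 1" for q
    by (induction q) (auto simp: word_sign_append word_sign_spike)
  then show ?thesis by (simp add: chiral_word_def word_sign_append word_sign_spike)
qed

lemma letter_count_chiral_word:
  assumes "H \<subseteq> {..<n}"
  shows "letter_count H j chiral_word = 2 ^ n * (2 * of_bool (j = 0) - 2 * of_bool (j = 1)) *
    (of_bool (H = {}) + \<mu> * (-1) ^ n * of_bool (H = {..<n}))"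
proof -
  have "letter_count H j (concat (replicate q (spike n {..<n}))) = of_nat q * (letter_count H j (spike n {..<n}) :: 'r)" for q
    by (induction q) (auto simp: letter_count_append word_sign_spike algebra_simps)
  then show ?thesis
    using assms n_ge_2 p by (simp add: chiral_word_def letter_count_append word_sign_spike letter_count_spike algebra_simps)
qed

lemma state_chiral_word: "state chiral_word = state []"
  unfolding state_eq_iff
proof (intro allI impI conjI)
  fix H j assume H: "H \<subseteq> {..<n}" "j < n"
  show "word_sign H chiral_word = (word_sign H [] :: 'r)" by (simp add: word_sign_chiral_word)
  have ne: "{..<n} \<noteq> {}" using n_ge_2 by (simp add: lessThan_empty_iff)
  have sq: "(-1 :: 'r) ^ n * (-1) ^ n = 1" by (simp flip: power_mult_distrib)
  have cancel: "\<mu> * (\<mu> * (2 * ((-1) ^ n * x))) = 2 * x" for x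
  proof -
    have "\<mu> * (\<mu> * (2 * ((-1) ^ n * x))) = \<mu> * \<mu> * (-1) ^ n * (2 * x)"
      by (simp add: algebra_simps)
    then show ?thesis using \<mu> sq by simp
  qed
  have eq: "{..<n} - H = {} \<longleftrightarrow> H = {..<n}" "{..<n} - H = {..<n} \<longleftrightarrow> H = {}"
    using H(1) by auto
  have "twist H j chiral_word = 0"
    unfolding twist_def letter_count_chiral_word[OF H(1)] letter_count_chiral_word[OF Diff_subset] eq
    using ne by (cases "H = {}"; cases "H = {..<n}") (simp_all add: algebra_simps cancel)
  then show "twist H j chiral_word = twist H j []" by (simp add: twist_def)
qed

lemma state_move_odd:
  assumes "u \<in> words n" "bij_betw \<pi> {..<n} {..<n}" "D \<subseteq> {..<n}" "odd (length u + card D)"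
  shows "state (u @ map (signed_perm \<pi> D) chiral_word) \<noteq> state (u @ map (signed_perm \<pi> D) [])"
proof
  assume eq: "state (u @ map (signed_perm \<pi> D) chiral_word) = state (u @ map (signed_perm \<pi> D) [])"
  obtain G where G: "G \<subseteq> {..<n}" "pull n \<pi> D G = {}" using pull_surj[OF assms(2,3), of "{}"] by auto
  have n0: "0 < n" using n_ge_2 by simp
  then have less: "\<pi> 0 < n" using assms(2) by (auto simp: bij_betw_def)
  let ?s = "letter_count {} 0 chiral_word + \<mu> * letter_count {..<n} 0 chiral_word"
  have "word_sign G u * ?s = word_sign G u * 0"
    using state_eqD(2)[OF eq G(1) less] twist_move[OF assms(1-3) chiral_word_words G(1) n0] assms(4) G(2) by simp
  then have "?s = 0" unfolding word_sign_cancel .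
  moreover have "letter_count {} 0 chiral_word - \<mu> * letter_count {..<n} 0 chiral_word = 0"
    using state_eqD(2)[OF state_chiral_word, of "{}" 0] n0 by (simp add: twist_def)
  ultimately have "2 * letter_count {} 0 chiral_word = (0 :: 'r)" by (simp add: algebra_simps)
  moreover have "letter_count {} 0 chiral_word = (2 :: 'r) ^ (n + 1)"
    using letter_count_chiral_word[of "{}" 0] n0 by auto
  ultimately have "(2 :: 'r) ^ (n + 2) = 0" by simp
  then show False using power_two_neq_zero by blast
qed

text \<open>
  A cell is encoded by its free coordinates, the values of the others, and the set of states of the cubes
  that contain it; these are finitely many data, so they embed into the natural numbers.
\<close>

theorem two_orbit_polytope_exists:
  "\<exists>P :: nat rel. abstract_polytope (n + 1) P \<and>
     isomorphic (symmetry_type_graph (n + 1) P) (two_vertex (n + 1) {1..n - 1})"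
proof -
  define descr where "descr w E A = (A, E - A, {state (w @ u) | u. u \<in> lists {(j, j \<in> E) | j. j < n \<and> j \<notin> A}})"
    for w E A
  let ?R = "{descr w E A | w E A. w \<in> words n \<and> E \<subseteq> {..<n} \<and> A \<subseteq> {..<n}}"
  have "?R \<subseteq> Pow {..<n} \<times> Pow {..<n} \<times> Pow (range state)"
    by (auto simp: descr_def)
  then have finite: "finite ?R"
    by (rule finite_subset) (simp add: finite_range_state)
  then obtain enc :: "_ \<Rightarrow> nat" where enc: "inj_on enc ?R"
    using finite_imp_inj_to_nat_seg[OF finite] by blast
  \<comment> \<open>The codes 0 and 1 are left for the least and the greatest face.\<close>
  define cell where "cell w E A = enc (descr w E A) + 2" for w E A
  interpret cube_gluing n state cell 0 1
  proof
    show "2 \<le> n" by (rule n_ge_2)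
    show "cell w E A = cell w' E' A' \<longleftrightarrow>
        A = A' \<and> E - A = E' - A \<and> (\<exists>u\<in>lists {(j, j \<in> E) | j. j < n \<and> j \<notin> A}. state (w @ u) = state w')"
      if "w \<in> words n" "w' \<in> words n" "E \<subseteq> {..<n}" "E' \<subseteq> {..<n}" "A \<subseteq> {..<n}" "A' \<subseteq> {..<n}" for w w' E E' A A'
    proof -
      let ?L = "lists {(j, j \<in> E) | j. j < n \<and> j \<notin> A}"
      have "cell w E A = cell w' E' A' \<longleftrightarrow> descr w E A = descr w' E' A'"
      proof -
        have "descr w E A \<in> ?R" "descr w' E' A' \<in> ?R" using that by blast+
        then show ?thesis unfolding cell_def using inj_on_eq_iff[OF enc] by simp
      qed
      also have "\<dots> \<longleftrightarrow> A = A' \<and> E - A = E' - A \<and> {state (w @ u) | u. u \<in> ?L} = {state (w' @ u) | u. u \<in> ?L}"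
      proof -
        have L: "{(j, j \<in> E') | j. j < n \<and> j \<notin> A} = {(j, j \<in> E) | j. j < n \<and> j \<notin> A}" if "E - A = E' - A"
          using that by auto
        show ?thesis
        proof (cases "A = A' \<and> E - A = E' - A")
          case True
          then have eq: "A' = A" "E' - A = E - A" by blast+
          have "descr w' E' A' = (A, E - A, {state (w' @ u) | u. u \<in> ?L})"
            unfolding descr_def eq L[OF eq(2)[symmetric]] ..
          then show ?thesis unfolding descr_def[of w E A] by (simp only: prod.inject eq)
        next
          case False
          then show ?thesis unfolding descr_def by (simp only: prod.inject) blast
        qed
      qed
      also have "{state (w @ u) | u. u \<in> ?L} = {state (w' @ u) | u. u \<in> ?L} \<longleftrightarrow> (\<exists>u\<in>?L. state (w @ u) = state w')"
      proof
        assume "{state (w @ u) | u. u \<in> ?L} = {state (w' @ u) | u. u \<in> ?L}"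
        moreover have "state w' \<in> {state (w' @ u) | u. u \<in> ?L}" by (auto intro: exI[of _ "[]"])
        ultimately have "state w' \<in> {state (w @ u) | u. u \<in> ?L}" by simp
        then show "\<exists>u\<in>?L. state (w @ u) = state w'" by force
      next
        assume "\<exists>u\<in>?L. state (w @ u) = state w'"
        then obtain v where v: "v \<in> ?L" "state (w @ v) = state w'" by blast
        have cancel: "state (a @ b @ rev b) = state a" for a b
        proof (induction b arbitrary: a)
          case (Cons c b)
          have "state (((a @ [c]) @ b @ rev b) @ [c]) = state ((a @ [c]) @ [c])"
            using Cons by (rule state_append)
          then show ?case using state_cancel[of a c] by simp
        qed simp
        have "state (w' @ u) = state (w @ (v @ u))" for u using state_append[OF v(2), of u] by simp
        moreover have "state (w @ u) = state (w' @ (rev v @ u))" for u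
        proof -
          have "state ((w @ v) @ (rev v @ u)) = state (w' @ (rev v @ u))" using v(2) by (rule state_append)
          moreover have "state ((w @ v @ rev v) @ u) = state (w @ u)" using cancel by (rule state_append)
          ultimately show ?thesis by simp
        qed
        moreover have "v @ u \<in> ?L" "rev v @ u \<in> ?L" if "u \<in> ?L" for u
          using that v(1) by auto
        ultimately show "{state (w @ u) | u. u \<in> ?L} = {state (w' @ u) | u. u \<in> ?L}" by blast
      qed
      finally show ?thesis .
    qed
    show "finite {cell w E A | w E A. w \<in> words n \<and> E \<subseteq> {..<n} \<and> A \<subseteq> {..<n}}"
    proof (rule finite_subset)
      show "{cell w E A | w E A. w \<in> words n \<and> E \<subseteq> {..<n} \<and> A \<subseteq> {..<n}} \<subseteq> (\<lambda>a. enc a + 2) ` ?R"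
        unfolding cell_def by blast
    qed (use finite in simp)
    show "state (w @ u) = state (w' @ u)" if "state w = state w'" for w w' u
      using that by (rule state_append)
    show "even (length w) \<longleftrightarrow> even (length w')"
      if "w \<in> words n" "w' \<in> words n" "state w = state w'" for w w'
      using that by (rule state_parity)
  qed (simp_all add: cell_def state_cancel)
  have "isomorphic (symmetry_type_graph (n + 1) ord) (two_vertex (n + 1) {1..n - 1})"
  proof (rule symmetry_type_graph_gluing)
    show "\<exists>v\<in>words n. \<exists>v'\<in>words n. state v = state v' \<and>
        state (u @ map (signed_perm \<pi> D) v) \<noteq> state (u @ map (signed_perm \<pi> D) v')"
      if "u \<in> words n" "bij_betw \<pi> {..<n} {..<n}" "D \<subseteq> {..<n}" "odd (length u + card D)" for u \<pi> D
      using state_move_odd[OF that] state_chiral_word chiral_word_words by (metis words_simps(1))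
  qed (rule state_move_even)
  then show ?thesis using abstract_polytope_gluing by blast
qed

end

theorem theorem6p8:
  fixes n :: nat
  assumes "n \<ge> 3"
  shows "\<exists>P :: nat rel.
           abstract_polytope (n + 1) P \<and>
           isomorphic (symmetry_type_graph (n + 1) P) (two_vertex (n + 1) {1..n - 1})"
proof (rule two_orbit_polytope_exists)
  show "2 \<le> n" using assms by simp
  let ?\<mu> = "if even n then 1 else 2 :: 5"
  show "?\<mu> * ?\<mu> = (-1) ^ n" by simp
  show "2 * 3 = (1 :: 5)" by simp
  show "of_nat (if even n then 1 else 3) = ?\<mu> * (-1) ^ n" by simp
qed

end
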